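(* Let $p\equiv 3 \pmod 8$ be prime. (1) There is no elliptic curve $E$ over $K=\mathbb{Q}(\sqrt{p})$ with everywhere good reduction over $K$ and $j(E)\in\mathbb{Q}$. (2) There is no elliptic curve $E$ over $K=\mathbb{Q}(\sqrt{-p})$ with everywhere good reduction over $K$ and $j(E)\in\mathbb{Q}$.
   Context: An elliptic curve $E/K$ has everywhere good reduction if it has good reduction at every prime of $\mathcal{O}_K$. *)

theory Defs
  imports Complex_Main "HOL-Computational_Algebra.Polynomial" "HOL-Algebra.Ideal"
begin

text \<open>The quadratic field Q(sqrt d), realised as a subfield of the complex numbers
  (for d < 0, csqrt d = i * sqrt(-d)).\<close>
definition quad_field :: "int \<Rightarrow> complex set" where
  "quad_field d = {of_rat a + of_rat b * csqrt (of_int d) | a b. True}"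

definition ring_of_integers :: "complex set \<Rightarrow> complex set" where
  "ring_of_integers K = {x \<in> K. algebraic_int x}"

text \<open>O_K as a ring structure (HOL-Algebra record), so that library prime ideals apply.\<close>
definition OK_ring :: "complex set \<Rightarrow> complex ring" where
  "OK_ring K = \<lparr>carrier = ring_of_integers K, mult = (*), one = 1, zero = 0, add = (+)\<rparr>"

definition primes_of :: "complex set \<Rightarrow> complex set set" where
  "primes_of K = {P. primeideal P (OK_ring K) \<and> P \<noteq> {0}}"

definition localisation :: "complex set \<Rightarrow> complex set \<Rightarrow> complex set" where
  "localisation K P = {x / y | x y. x \<in> ring_of_integers K \<and> y \<in> ring_of_integers K \<and> y \<notin> P}"

text \<open>Weierstrass equations y^2 + a1 xy + a3 y = x^3 + a2 x^2 + a4 x + a6,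
  given by the coefficient tuple (a1,a2,a3,a4,a6).\<close>
type_synonym weierstrass = "complex \<times> complex \<times> complex \<times> complex \<times> complex"

fun wdisc :: "weierstrass \<Rightarrow> complex" where
  "wdisc (a1,a2,a3,a4,a6) =
    (let b2 = a1^2 + 4*a2; b4 = 2*a4 + a1*a3; b6 = a3^2 + 4*a6;
         b8 = a1^2*a6 + 4*a2*a6 - a1*a3*a4 + a2*a3^2 - a4^2
     in (- (b2^2*b8)) - 8*b4^3 - 27*b6^2 + 9*b2*b4*b6)"

fun wc4 :: "weierstrass \<Rightarrow> complex" where
  "wc4 (a1,a2,a3,a4,a6) =
    (let b2 = a1^2 + 4*a2; b4 = 2*a4 + a1*a3 in b2^2 - 24*b4)"

definition j_invariant :: "weierstrass \<Rightarrow> complex" where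
  "j_invariant E = wc4 E ^ 3 / wdisc E"

fun elliptic_curve_over :: "complex set \<Rightarrow> weierstrass \<Rightarrow> bool" where
  "elliptic_curve_over K (a1,a2,a3,a4,a6) \<longleftrightarrow>
     a1 \<in> K \<and> a2 \<in> K \<and> a3 \<in> K \<and> a4 \<in> K \<and> a6 \<in> K \<and> wdisc (a1,a2,a3,a4,a6) \<noteq> 0"

text \<open>Standard change of variables x = u^2 x' + r, y = u^3 y' + s u^2 x' + t (Silverman III.1).\<close>
fun change_coords :: "complex \<Rightarrow> complex \<Rightarrow> complex \<Rightarrow> complex \<Rightarrow> weierstrass \<Rightarrow> weierstrass" where
  "change_coords u r s t (a1,a2,a3,a4,a6) =
    ((a1 + 2*s) / u,
     (a2 - s*a1 + 3*r - s^2) / u^2,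
     (a3 + r*a1 + 2*t) / u^3,
     (a4 - s*a3 + 2*r*a2 - (t + r*s)*a1 + 3*r^2 - 2*s*t) / u^4,
     (a6 + r*a4 + r^2*a2 + r^3 - t*a3 - t^2 - r*t*a1) / u^6)"

text \<open>E has good reduction at P: some K-isomorphic Weierstrass model has
  P-integral coefficients and P-unit discriminant (equivalently, the minimal
  model at P has nonsingular reduction).\<close>
definition good_reduction_at :: "complex set \<Rightarrow> complex set \<Rightarrow> weierstrass \<Rightarrow> bool" where
  "good_reduction_at K P E \<longleftrightarrow>
     (\<exists>u\<in>K. \<exists>r\<in>K. \<exists>s\<in>K. \<exists>t\<in>K. u \<noteq> 0 \<and>
        (case change_coords u r s t E of (b1,b2,b3,b4,b6) \<Rightarrow>
           b1 \<in> localisation K P \<and> b2 \<in> localisation K P \<and> b3 \<in> localisation K P \<and>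
           b4 \<in> localisation K P \<and> b6 \<in> localisation K P) \<and>
        wdisc (change_coords u r s t E) \<in> localisation K P \<and>
        inverse (wdisc (change_coords u r s t E)) \<in> localisation K P)"

definition everywhere_good_reduction :: "complex set \<Rightarrow> weierstrass \<Rightarrow> bool" where
  "everywhere_good_reduction K E \<longleftrightarrow> (\<forall>P \<in> primes_of K. good_reduction_at K P E)"

end

theory Submission
  imports Defs "HOL-Computational_Algebra.Computational_Algebra"
begin

text \<open>Let E have good reduction everywhere over K and rational j. Writing c4^3 = j D and
  c6^2 = (j - 1728) D, local models with unit discriminant show that j is an integer J whose
  valuations are all divisible by 3, so J is a cube; that the norm of D is, up to sign, a fourth
  power; and that J - 1728 has even valuation at every unramified prime. Hence the absolute value
  of the norm of c6 is |J - 1728| times a square, and likewise that of c4 is a square.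

  The prime 2 is ramified in Q(sqrt p) and inert in Q(sqrt (-p)). Congruences between the
  invariants of a model with good reduction at 2 determine the norm of c6 up to squares modulo 8
  (real case) or modulo 4 (imaginary case). As p is 3 modulo 8, this excludes that |J - 1728| is p
  times a square, so |J - 1728| is a square, and moreover J is odd or divisible by 2^12. The one
  remaining reduction type at 2, in the real case with a1 of valuation one, makes the norm of c4
  congruent to 5 modulo 8 up to squares, which contradicts that it is a square up to sign.

  Finally |J - 1728| is never a square: for J = 2^12 i divide by 64 and reduce modulo 8; for
  J = a^3 odd, the factors a - 12 and a^2 + 12 a + 144 of a^3 - 12^3 are coprime up to powers of 3,
  and the second one, stripped of these, would be a square, which fails modulo 8.\<close>

subsection \<open>Squares, multiplicities and Hensel lifting over the integers\<close>

text \<open>Norms are used because the ideal generated by D is a twelfth power, while D itself is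
  known only up to units, of which the real field has infinitely many; absolute norms remove them.
  Modulo squares the unknown scalings between global and local models disappear too, since they
  enter c4, c6 and D with even weights. A fourth power is wanted for the norm of D because the norm
  of c6 is, up to sign, J - 1728 times the square root of that norm, and this root has to be a
  square again.

  Evenness of the valuations of J - 1728 breaks down at ramified primes, where the valuation of
  every rational integer is even anyway. So p may divide J - 1728 to an odd power, and this has to
  be excluded by information at the other prime 2. Absolute values cost a sign there: norms from the
  real field may be negative, which is why the real case needs congruences modulo 8, whereas norms
  from the imaginary field are nonnegative and congruences modulo 4 suffice.\<close>

lemma odd_square_mod_8:
  fixes x :: int assumes "odd x" shows "x^2 mod 8 = 1"
proof -
  obtain k where k: "x = 2*k+1" using assms by (rule oddE)
  have "even (k*(k+1))" by simp
  then obtain m where m: "k*(k+1) = 2*m" by (rule evenE)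
  have "x^2 = 4*(k*(k+1)) + 1" unfolding k by (simp add: power2_eq_square algebra_simps)
  then have "x^2 = 8*m+1" using m by simp
  then show ?thesis by presburger
qed

text \<open>An integer that is a ratio of two squares is itself a square. This turns identities
  known only up to square factors into congruences.\<close>

lemma square_ratio_mod_8:
  fixes c x y :: int
  assumes "odd c" "x \<noteq> 0" "c * x^2 = y^2"
  shows "c mod 8 = 1"
proof -
  have "x^2 dvd y^2" using assms(3) by (metis dvd_triv_right)
  then have "x dvd y" by simp
  then obtain k where "y = x*k" by (rule dvdE)
  with assms(3) have "x^2 * c = x^2 * k^2" by (simp add: power_mult_distrib mult.commute)
  with assms(2) have "c = k^2" by simp
  with assms(1) show ?thesis by (auto simp: odd_square_mod_8)
qed

lemma prime_3_int: "prime (3::int)" by simp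

lemma abs_is_nth_power:
  fixes a :: int
  assumes "a \<noteq> 0" "k > 0" "\<And>q::int. prime q \<Longrightarrow> k dvd multiplicity q a"
  shows "\<exists>b::nat. \<bar>a\<bar> = int b ^ k"
proof -
  have "is_nth_power k (nat \<bar>a\<bar>)"
  proof (subst is_nth_power_conv_multiplicity_nat)
    show "k > 0" by fact
    show "\<forall>p. prime p \<longrightarrow> k dvd multiplicity p (nat \<bar>a\<bar>)"
    proof (intro allI impI)
      fix p :: nat assume "prime p"
      then have pr: "prime (int p)" by simp
      have dvd_iff: "p ^ j dvd nat \<bar>a\<bar> \<longleftrightarrow> int p ^ j dvd a" for j
        by (metis int_dvd_int_iff of_nat_power int_nat_eq abs_ge_zero dvd_abs_iff)
      have nu: "\<not> is_unit (int p)" using pr not_prime_unit by blast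
      have "multiplicity p (nat \<bar>a\<bar>) = multiplicity (int p) a"
      proof (rule multiplicity_eqI)
        show "p ^ multiplicity (int p) a dvd nat \<bar>a\<bar>" 
          unfolding dvd_iff by (rule multiplicity_dvd)
        show "\<not> p ^ Suc (multiplicity (int p) a) dvd nat \<bar>a\<bar>"
          unfolding dvd_iff using assms(1) nu by (simp add: power_dvd_iff_le_multiplicity del: power_Suc)
      qed
      then show "k dvd multiplicity p (nat \<bar>a\<bar>)" using assms(3)[OF pr] by simp
    qed
  qed
  then obtain b where "nat \<bar>a\<bar> = b ^ k" by (rule is_nth_powerE)
  then have "\<bar>a\<bar> = int b ^ k" by (metis abs_ge_zero int_nat_eq of_nat_power)
  then show ?thesis by blast
qed

lemma odd_power_root:
  fixes a :: int
  assumes "odd k" "\<bar>a\<bar> = int b ^ k"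
  shows "\<exists>c. a = c ^ k"
proof (cases "a \<ge> 0")
  case True with assms(2) show ?thesis by (intro exI[of _ "int b"]) simp
next
  case False
  then have "a = (- int b)^k" using assms by (simp add: power_minus_odd)
  then show ?thesis by blast
qed

lemma coprime_mult_square:
  fixes x y z :: int
  assumes "coprime x y" "\<bar>x * y\<bar> = z^2" "y > 0"
  obtains r where "y = r^2"
proof -
  have "is_nth_power 2 (nat \<bar>x\<bar> * nat \<bar>y\<bar>)"
  proof (rule is_nth_powerI)
    show "nat \<bar>x\<bar> * nat \<bar>y\<bar> = nat \<bar>z\<bar> ^ 2"
      using assms(2) by (metis abs_mult nat_abs_mult_distrib nat_power_eq abs_ge_zero power2_abs)
  qed
  moreover have "coprime (nat \<bar>x\<bar>) (nat \<bar>y\<bar>)" using assms(1) by simp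
  ultimately have "is_nth_power 2 (nat \<bar>y\<bar>)" by (simp add: is_nth_power_mult_coprime_nat_iff)
  then obtain r where "nat \<bar>y\<bar> = r^2" by (rule is_nth_powerE)
  then have "y = (int r)^2" using assms(3) by (metis abs_of_pos int_nat_eq less_imp_le of_nat_power)
  then show ?thesis by (rule that)
qed

lemma abs_cube_minus_1728_not_square:
  fixes a x :: int
  assumes "odd a"
  shows "\<bar>a^3 - 1728\<bar> \<noteq> x^2"
proof
  assume eq: "\<bar>a^3 - 1728\<bar> = x^2"
  show False
  proof (cases "3 dvd a")
    case False
    define Q where "Q = a^2 + 12*a + 144"
    \<comment> \<open>Here 108 is 4 modulo 8, whereas two odd squares agree modulo 8.\<close>
    have Qeq: "Q = (a+6)^2 + 108" unfolding Q_def by (simp add: power2_eq_square algebra_simps)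
    have Qpos: "Q > 0" unfolding Qeq by (simp add: add_nonneg_pos)
    have "a^3 - 1728 = (a-12)*Q" unfolding Q_def by (simp add: power2_eq_square power3_eq_cube algebra_simps)
    with eq have fac: "\<bar>(a-12)*Q\<bar> = x^2" by simp
    have "coprime (a-12) Q"
    proof (rule ccontr)
      assume "\<not> coprime (a-12) Q"
      then obtain c where c: "c dvd a-12" "c dvd Q" "\<not> is_unit c" by (rule not_coprimeE)
      then have "c \<noteq> 0" using Qpos by auto
      then obtain q where q: "prime q" "q dvd a-12" "q dvd Q"
        using c prime_divisor_exists[of c] by (meson dvd_trans)
      \<comment> \<open>The constant 432 is the value of the quadratic factor at a = 12, so only 2
        and 3 can divide both factors.\<close>
      have "Q = (a-12)*(a+24) + 432" unfolding Q_def by (simp add: power2_eq_square algebra_simps)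
      then have "q dvd 432" using q by (metis dvd_add_right_iff dvd_mult2)
      then have "q dvd 2^4 * 3^3" by simp
      then have "q dvd 2 \<or> q dvd 3" using q(1) by (meson prime_dvd_mult_iff prime_dvd_power)
      then have "q = 2 \<or> q = 3" using q(1) primes_dvd_imp_eq[of q 2] primes_dvd_imp_eq[of q 3] by auto
      then show False
      proof
        assume "q = 2" with q(2) assms show False by simp
      next
        assume "q = 3"
        with q(2) have "3 dvd a - 12" by simp
        with False show False by presburger
      qed
    qed
    from coprime_mult_square[OF this fac Qpos] obtain r where r: "Q = r^2" .
    have "odd Q" unfolding Q_def using assms by simp
    then have "odd r" using r by simp
    then have "r^2 mod 8 = 1" "(a+6)^2 mod 8 = 1" using assms by (simp_all add: odd_square_mod_8)
    then have "8 dvd r^2 - (a+6)^2" by (metis mod_eq_dvd_iff)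
    moreover have "r^2 - (a+6)^2 = 108" using r Qeq by simp
    ultimately show False by simp
  next
    case True
    \<comment> \<open>The substitutions that follow strip the powers of 3. They end with a = 27*f +
      12, where a - 12 = 27*f and a^2 + 12*a + 144 = 27*(27*f^2 + 36*f + 16).\<close>
    then obtain b where b: "a = 3*b" by (rule dvdE)
    have c1: "a^3 - 1728 = 27*(b^3 - 64)" unfolding b by (simp add: power3_eq_cube)
    then have x27: "27 * \<bar>b^3-64\<bar> = x^2" using eq unfolding c1 by (simp only: abs_mult abs_numeral)
    then have "x^2 = 3 * (9 * \<bar>b^3-64\<bar>)" by simp
    then have "3 dvd x^2" by (rule dvdI)
    then have "3 dvd x" using prime_dvd_power[OF prime_3_int] by blast
    then obtain y where y: "x = 3*y" by (rule dvdE)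
    have y3: "3 * \<bar>b^3-64\<bar> = y^2" using x27 unfolding y by (simp add: power2_eq_square)
    then have "3 dvd y^2" by (metis dvd_triv_left)
    then have "3 dvd y" using prime_dvd_power[OF prime_3_int] by blast
    then obtain z where z: "y = 3*z" by (rule dvdE)
    have z3: "\<bar>b^3-64\<bar> = 3*z^2" using y3 unfolding z by (simp add: power2_eq_square)
    have "3 dvd b^3 - 64" using z3 by (metis dvd_abs_iff dvd_triv_left)
    moreover have "b mod 3 = 0 \<or> b mod 3 = 1 \<or> b mod 3 = 2" by presburger
    ultimately have "b mod 3 = 1"
    proof -
      have "(b^3 - 64) mod 3 = ((b mod 3)^3 - 64) mod 3" by (metis mod_diff_left_eq power_mod)
      moreover have "(b^3 - 64) mod 3 = 0" using \<open>3 dvd b^3 - 64\<close> by simp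
      ultimately show ?thesis using \<open>b mod 3 = 0 \<or> b mod 3 = 1 \<or> b mod 3 = 2\<close> by auto
    qed
    then obtain e where e: "b = 3*e+1" by (metis mult_div_mod_eq)
    have "b^3 - 64 = 9 * ((e-1)*(3*e^2+6*e+7))" unfolding e
      by (simp add: power2_eq_square power3_eq_cube algebra_simps)
    then have e3: "3 * \<bar>(e-1)*(3*e^2+6*e+7)\<bar> = z^2" using z3 by (simp only: abs_mult abs_numeral)
    then have "3 dvd z^2" by (metis dvd_triv_left)
    then have "3 dvd z" using prime_dvd_power[OF prime_3_int] by blast
    then obtain s where s: "z = 3*s" by (rule dvdE)
    have e4: "\<bar>(e-1)*(3*e^2+6*e+7)\<bar> = 3*s^2" using e3 unfolding s by (simp add: power2_eq_square)
    then have "3 dvd (e-1)*(3*e^2+6*e+7)" by (metis dvd_abs_iff dvd_triv_left)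
    then have "3 dvd e - 1 \<or> 3 dvd 3*e^2+6*e+7" using prime_dvd_mult_iff[OF prime_3_int] by blast
    moreover have "3*e^2+6*e+7 = 3*(e^2+2*e+2) + 1" by simp
    then have "(3*e^2+6*e+7) mod 3 = 1" by presburger
    then have "\<not> 3 dvd 3*e^2+6*e+7" by (simp add: dvd_eq_mod_eq_0)
    ultimately have "3 dvd e - 1" by blast
    then obtain f where f: "e - 1 = 3*f" by (rule dvdE)
    define Q where "Q = 27*f^2 + 36*f + 16"
    have ef: "e = 3*f+1" using f by simp
    have fe: "(e-1)*(3*e^2+6*e+7) = 3*(f*Q)" unfolding Q_def ef
      by (simp add: power2_eq_square algebra_simps)
    have fQ: "\<bar>f*Q\<bar> = s^2" using e4 unfolding fe abs_mult by simp
    have oddf: "odd f" using assms unfolding b e ef by simp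
    have Q4: "Q = 3*(3*f+2)^2 + 4" unfolding Q_def by (simp add: power2_eq_square algebra_simps)
    then have Qpos: "Q > 0" by (simp add: add_nonneg_pos)
    have "coprime f Q"
    proof -
      have "coprime f 2" using oddf by simp
      then have "coprime f (2^4)" unfolding coprime_power_right_iff by simp
      then have "coprime f 16" by simp
      then have "coprime f (f*(27*f+36) + 16)" unfolding coprime_def
        by (metis dvd_add_right_iff dvd_mult2)
      moreover have "Q = f*(27*f+36) + 16" unfolding Q_def by (simp add: power2_eq_square algebra_simps)
      ultimately show ?thesis by simp
    qed
    from coprime_mult_square[OF this fQ Qpos] obtain r where r: "Q = r^2" .
    have "odd Q" unfolding Q_def using oddf by simp
    then have "r^2 mod 8 = 1" using r by (simp add: odd_square_mod_8)
    then have "Q mod 8 = 1" using r by simp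
    moreover obtain g where g: "f = 2*g+1" using oddf by (rule oddE)
    obtain m where m: "f^2 = 8*m+1" using odd_square_mod_8[OF oddf] by (metis mult_div_mod_eq)
    have "Q = 27*(8*m+1) + 36*f + 16" unfolding Q_def m ..
    then have "Q = 7 + 8*(27*m+9*g+9)" unfolding g by simp
    then have "Q mod 8 = 7" by (simp only: mod_mult_self2) simp
    ultimately show False by simp
  qed
qed

lemma multiplicity_mult_prime:
  fixes a b q :: int
  assumes "prime q" "a \<noteq> 0" "b \<noteq> 0"
  shows "multiplicity q (a * b) = multiplicity q a + multiplicity q b"
  using assms by (intro prime_elem_multiplicity_mult_distrib prime_imp_prime_elem)

lemma multiplicity_power_prime:
  fixes a q :: int
  assumes "prime q" "a \<noteq> 0"
  shows "multiplicity q (a ^ k) = k * multiplicity q a"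
  using assms by (intro prime_elem_multiplicity_power_distrib prime_imp_prime_elem)

text \<open>A valuation below k is already visible modulo q^k. This allows truncations modulo q^k to
  stand for q-adic numbers.\<close>

lemma multiplicity_cong_power:
  fixes a b q :: int
  assumes "prime q" "q ^ k dvd a - b" "b \<noteq> 0" "multiplicity q b < k"
  shows "a \<noteq> 0 \<and> multiplicity q a = multiplicity q b"
proof -
  let ?m = "multiplicity q b"
  have nu: "\<not> is_unit q" using assms(1) by auto
  have "q ^ ?m dvd a - b" "q ^ Suc ?m dvd a - b"
    using assms(2,4) by (meson dvd_trans le_imp_power_dvd less_imp_le Suc_leI)+
  moreover have "q ^ ?m dvd b" by (rule multiplicity_dvd)
  moreover have "\<not> q ^ Suc ?m dvd b" using nu assms(3) by (simp add: power_dvd_iff_le_multiplicity del: power_Suc)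
  ultimately have 1: "q ^ ?m dvd a" and 2: "\<not> q ^ Suc ?m dvd a"
    by (metis dvd_diff_right_iff diff_add_cancel dvd_add_right_iff, metis dvd_diff_right_iff)
  then have "a \<noteq> 0" by auto
  moreover have "multiplicity q a = ?m" using 1 2 by (rule multiplicity_eqI)
  ultimately show ?thesis by simp
qed

text \<open>The sequence R represents a root in the q-adic integers by its truncations. The number
  \<open>2*r - t\<close> is the derivative at r, so the assumption says that r is a simple root
  modulo q.\<close>

lemma hensel_quadratic:
  fixes q r t n :: int
  assumes q: "prime q" and r: "q dvd r^2 - t*r + n" and sep: "\<not> q dvd 2*r - t"
  obtains R where "\<And>k. q ^ k dvd R k ^ 2 - t * R k + n" "\<And>k. q dvd R k - r"
    "\<And>k l. k \<le> l \<Longrightarrow> q ^ k dvd R l - R k"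
proof -
  have "\<exists>x. q ^ k dvd x^2 - t*x + n \<and> q dvd x - r" for k
  proof (induction k)
    case 0 show ?case by (rule exI[of _ r]) simp
  next
    case (Suc k)
    show ?case
    \<comment> \<open>For k = 0 a correction by a multiple of q^k could leave the residue class of
      r; r itself serves.\<close>
    proof (cases "k = 0")
      case True then show ?thesis using r by (intro exI[of _ r]) simp
    next
      case False
      from Suc obtain x where x: "q ^ k dvd x^2 - t*x + n" "q dvd x - r" by blast
      then obtain c where c: "x^2 - t*x + n = q^k * c" by (auto elim: dvdE)
      have "\<not> q dvd 2*x - t"
      proof
        assume "q dvd 2*x - t"
        moreover have "2*r - t = (2*x - t) - 2*(x - r)" by simp
        ultimately show False using sep x(2) by (metis dvd_diff dvd_mult)
      qed
      with q have "coprime q (2*x - t)" by (rule prime_imp_coprime)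
      then obtain a b where ab: "a*q + b*(2*x-t) = 1" by (metis coprime_iff_gcd_eq_1 bezout_int)
      \<comment> \<open>A Newton step, with b inverse to the derivative modulo q.\<close>
      define y where "y = x - q^k * (b*c)"
      have "q dvd q^k" using False by simp
      then have qk: "q^k * q dvd q^k * q^k" by simp
      have "y^2 - t*y + n = (x^2 - t*x + n) - q^k*(b*c)*(2*x-t) + q^k*q^k*(b*c)^2"
        unfolding y_def by (simp add: power2_eq_square algebra_simps)
      also have "\<dots> = q^k*(c*(1 - b*(2*x-t))) + q^k*q^k*(b*c)^2"
        unfolding c by (simp add: algebra_simps)
      also have "1 - b*(2*x-t) = a*q" using ab by simp
      finally have "y^2 - t*y + n = (q^k*q)*(c*a) + (q^k*q^k)*(b*c)^2" by (simp add: algebra_simps)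
      then have "q ^ Suc k dvd y^2 - t*y + n" using qk
        by (metis dvd_add dvd_mult2 dvd_triv_left power_Suc2)
      moreover have "q dvd y - r"
      proof -
        have "y - r = (x - r) - q^k*(b*c)" unfolding y_def by simp
        then show ?thesis using x(2) \<open>q dvd q^k\<close> by (metis dvd_diff dvd_mult2)
      qed
      ultimately show ?thesis by blast
    qed
  qed
  then obtain R where R: "\<And>k. q ^ k dvd R k ^ 2 - t * R k + n" "\<And>k. q dvd R k - r" by metis
  \<comment> \<open>The R k were chosen independently of each other; compatibility comes from
    uniqueness. The difference of two values of the polynomial is R l - R k times a factor congruent
    to \<open>2*r - t\<close> modulo q.\<close>
  have "q ^ k dvd R l - R k" if "k \<le> l" for k l
  proof -
    have "q ^ k dvd R l ^ 2 - t * R l + n" using R(1) that by (meson dvd_trans le_imp_power_dvd)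
    then have "q ^ k dvd (R l ^ 2 - t * R l + n) - (R k ^ 2 - t * R k + n)" using R(1) by (rule dvd_diff)
    also have "\<dots> = (R l - R k) * (R l + R k - t)" by (simp add: power2_eq_square algebra_simps)
    finally have d: "q ^ k dvd (R l - R k) * (R l + R k - t)" .
    have "\<not> q dvd R l + R k - t"
    proof
      assume "q dvd R l + R k - t"
      moreover have "2*r - t = (R l + R k - t) - ((R l - r) + (R k - r))" by simp
      ultimately show False using sep R(2) by (metis dvd_add dvd_diff)
    qed
    then have "coprime (q^k) (R l + R k - t)" using q by (simp add: prime_imp_coprime)
    with d show ?thesis by (simp add: coprime_dvd_mult_left_iff)
  qed
  with R show ?thesis by (rule that)
qed

subsection \<open>Quadratic rings\<close>

text \<open>The generator w has trace t and norm n. With (t, n) = (0, -p) and (1, (1+p)/4) the two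
  fields share one development.\<close>

locale quad_ring =
  fixes w :: complex and t n :: int
  assumes root: "w^2 = of_int t * w - of_int n"
    and indep: "\<And>x y :: int. of_int x + of_int y * w = 0 \<Longrightarrow> x = 0 \<and> y = 0"
begin

definition el :: "int \<Rightarrow> int \<Rightarrow> complex" where
  "el x y = of_int x + of_int y * w"

definition Zw :: "complex set" where
  "Zw = {el x y | x y. True}"

text \<open>The product of x + y*w and its conjugate x + t*y - y*w, in coordinates. Nothing is known
  outside \<open>Zw\<close>, hence the membership assumptions in the rules for
  \<open>nrm\<close>.\<close>

definition nrm :: "complex \<Rightarrow> int" where
  "nrm z = (THE k. \<exists>x y. z = el x y \<and> k = x^2 + t*x*y + n*y^2)"

lemma el_eq_iff [simp]: "el a b = el c d \<longleftrightarrow> a = c \<and> b = d"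
proof
  assume "el a b = el c d"
  then have "of_int (a-c) + of_int (b-d) * w = 0" by (simp add: el_def algebra_simps)
  from indep[OF this] show "a = c \<and> b = d" by simp
qed simp

lemma el_cases:
  assumes "z \<in> Zw" obtains x y where "z = el x y"
  using assms by (auto simp: Zw_def)

lemma el_in [simp, intro]: "el x y \<in> Zw"
  by (auto simp: Zw_def)

lemma el_add: "el a b + el c d = el (a+c) (b+d)"
  by (simp add: el_def algebra_simps)

lemma el_minus: "- el a b = el (-a) (-b)"
  by (simp add: el_def algebra_simps)

lemma el_mult: "el a b * el c d = el (a*c - n*b*d) (a*d + b*c + t*b*d)"
proof -
  have "el a b * el c d = of_int (a*c) + of_int (a*d + b*c) * w + of_int (b*d) * w^2"
    by (simp add: el_def algebra_simps power2_eq_square)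
  then show ?thesis by (simp add: root el_def algebra_simps)
qed

lemma of_int_eq_el: "of_int k = el k 0"
  by (simp add: el_def)

lemma el_eq_0_iff [simp]: "el a b = 0 \<longleftrightarrow> a = 0 \<and> b = 0"
  using el_eq_iff[of a b 0 0] by (simp add: el_def)

lemma Zw_of_int [simp, intro]: "of_int k \<in> Zw"
  by (simp add: of_int_eq_el)

lemma Zw_consts [simp, intro]: "0 \<in> Zw" "1 \<in> Zw" "numeral m \<in> Zw"
  using Zw_of_int[of 0] Zw_of_int[of 1] Zw_of_int[of "numeral m"] by simp_all

lemma Zw_add [simp, intro]: "a \<in> Zw \<Longrightarrow> b \<in> Zw \<Longrightarrow> a + b \<in> Zw"
  by (metis el_add el_cases el_in)

lemma Zw_mult [simp, intro]: "a \<in> Zw \<Longrightarrow> b \<in> Zw \<Longrightarrow> a * b \<in> Zw"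
  by (metis el_mult el_cases el_in)

lemma Zw_uminus [simp, intro]: "a \<in> Zw \<Longrightarrow> - a \<in> Zw"
  by (metis el_minus el_cases el_in)

lemma Zw_diff [simp, intro]: "a \<in> Zw \<Longrightarrow> b \<in> Zw \<Longrightarrow> a - b \<in> Zw"
  using Zw_add[of a "-b"] by simp

lemma Zw_power [simp, intro]: "a \<in> Zw \<Longrightarrow> a ^ k \<in> Zw"
  by (induction k) auto

lemma nrm_el [simp]: "nrm (el x y) = x^2 + t*x*y + n*y^2"
  unfolding nrm_def by (rule the_equality) auto

lemma nrm_mult: "a \<in> Zw \<Longrightarrow> b \<in> Zw \<Longrightarrow> nrm (a * b) = nrm a * nrm b"
  by (elim el_cases) (simp add: el_mult power2_eq_square algebra_simps)

lemma nrm_of_int [simp]: "nrm (of_int k) = k^2"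
  by (simp add: of_int_eq_el)

lemma nrm_consts [simp]: "nrm 0 = 0" "nrm 1 = 1" "nrm (numeral m) = (numeral m)^2"
  using nrm_of_int[of 0] nrm_of_int[of 1] nrm_of_int[of "numeral m"] by simp_all

lemma nrm_power: "a \<in> Zw \<Longrightarrow> nrm (a ^ k) = nrm a ^ k"
  by (induction k) (simp_all add: nrm_mult)

lemma nrm_uminus [simp]: "a \<in> Zw \<Longrightarrow> nrm (- a) = nrm a"
  by (elim el_cases) (simp add: el_minus)

text \<open>B is the trace of z times the conjugate of y. For even t all traces are even, and this
  gains a factor 2 in the congruences for the real field.\<close>

lemma nrm_add_scaled:
  assumes "z \<in> Zw" "y \<in> Zw"
  obtains B where "nrm (z + of_int k * y) = nrm z + k * B + k^2 * nrm y" "even t \<Longrightarrow> even B"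
proof -
  from assms obtain a b c d where zy: "z = el a b" "y = el c d" by (metis el_cases)
  have "of_int k * y = el (k*c) (k*d)" unfolding zy by (simp add: el_def algebra_simps)
  then have "nrm (z + of_int k * y) = nrm z + k * (2*a*c + t*(a*d+b*c) + 2*n*b*d) + k^2 * nrm y"
    unfolding zy by (simp add: el_add power2_eq_square algebra_simps)
  then show ?thesis by (rule that) simp
qed

lemma nrm_eq_0_iff: 
  assumes "z \<in> Zw" shows "nrm z = 0 \<longleftrightarrow> z = 0"
proof -
  from assms obtain x y where z: "z = el x y" by (rule el_cases)
  \<comment> \<open>The second factor is the conjugate of z.\<close>
  have "el x y * el (x + t*y) (-y) = of_int (nrm z)"
    unfolding z of_int_eq_el by (simp add: el_mult power2_eq_square algebra_simps)
  moreover have "el (x + t*y) (-y) = 0 \<longleftrightarrow> z = 0" unfolding z by auto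
  ultimately show ?thesis using z by (metis mult_eq_0_iff of_int_eq_0_iff)
qed

end

locale quad_integers = quad_ring +
  fixes K :: "complex set"
  assumes integers: "ring_of_integers K = Zw"
    and K_denom: "\<And>z. z \<in> K \<Longrightarrow> \<exists>m>0. of_int m * z \<in> Zw"
begin

lemma cring_OK: "cring (OK_ring K)"
proof (rule cringI)
  show "abelian_group (OK_ring K)"
  proof (rule abelian_groupI)
    fix x assume "x \<in> carrier (OK_ring K)"
    then show "\<exists>y\<in>carrier (OK_ring K). y \<oplus>\<^bsub>OK_ring K\<^esub> x = \<zero>\<^bsub>OK_ring K\<^esub>"
      by (intro bexI[of _ "-x"]) (auto simp: OK_ring_def integers)
  qed (auto simp: OK_ring_def integers)
  show "comm_monoid (OK_ring K)"
    by (rule comm_monoidI) (auto simp: OK_ring_def integers)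
qed (auto simp: OK_ring_def distrib_right)

lemma primes_ofI:
  assumes sub: "P \<subseteq> Zw" and add: "\<And>a b. a \<in> P \<Longrightarrow> b \<in> P \<Longrightarrow> a + b \<in> P"
    and mult: "\<And>a b. a \<in> P \<Longrightarrow> b \<in> Zw \<Longrightarrow> b * a \<in> P"
    and prime: "\<And>a b. a \<in> Zw \<Longrightarrow> b \<in> Zw \<Longrightarrow> a * b \<in> P \<Longrightarrow> a \<in> P \<or> b \<in> P"
    and one: "1 \<notin> P" and q: "q \<in> P" "q \<noteq> 0"
  shows "P \<in> primes_of K"
proof -
  have zero: "0 \<in> P" using mult[OF q(1), of 0] by simp
  have neg: "- a \<in> P" if "a \<in> P" for a using mult[OF that, of "-1"] by simp
  have "primeideal P (OK_ring K)"
  proof (rule primeidealI2)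
    interpret cring "OK_ring K" by (rule cring_OK)
    show "additive_subgroup P (OK_ring K)"
    proof (rule additive_subgroupI, rule subgroup.intro)
      fix x assume x: "x \<in> P"
      then have "x \<in> carrier (OK_ring K)" "-x \<in> carrier (OK_ring K)" 
        using sub by (auto simp: OK_ring_def integers)
      then have "\<ominus>\<^bsub>OK_ring K\<^esub> x = - x"
        by (intro minus_equality) (auto simp: OK_ring_def)
      then show "inv\<^bsub>add_monoid (OK_ring K)\<^esub> x \<in> P" using neg[OF x] by (simp add: a_inv_def)
    qed (use sub add zero in \<open>auto simp: OK_ring_def integers\<close>)
    show "carrier (OK_ring K) \<noteq> P" using one by (auto simp: OK_ring_def integers)
  qed (use cring_OK mult prime in \<open>auto simp: OK_ring_def integers mult.commute\<close>)
  with q show ?thesis by (auto simp: primes_of_def)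
qed

lemma prime_of_props:
  assumes "P \<in> primes_of K"
  shows "P \<subseteq> Zw" "0 \<in> P" "1 \<notin> P"
    "\<And>a b. a \<in> P \<Longrightarrow> b \<in> Zw \<Longrightarrow> a * b \<in> P"
    "\<And>a b. a \<in> Zw \<Longrightarrow> b \<in> Zw \<Longrightarrow> a * b \<in> P \<Longrightarrow> a \<in> P \<or> b \<in> P"
proof -
  have p: "primeideal P (OK_ring K)" using assms by (simp add: primes_of_def)
  then interpret primeideal P "OK_ring K" .
  show "P \<subseteq> Zw" using a_subset by (auto simp: OK_ring_def integers)
  show "0 \<in> P" using additive_subgroup.zero_closed[OF additive_subgroup_axioms] by (simp add: OK_ring_def)
  show "1 \<notin> P" using one_imp_carrier I_notcarr by (auto simp: OK_ring_def)
  show "a * b \<in> P" if "a \<in> P" "b \<in> Zw" for a b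
    using I_r_closed[of a b] that by (simp add: OK_ring_def integers)
  show "a \<in> P \<or> b \<in> P" if "a \<in> Zw" "b \<in> Zw" "a * b \<in> P" for a b
    using I_prime[of a b] that by (simp add: OK_ring_def integers)
qed

end

subsection \<open>Places above a rational prime\<close>

context quad_integers begin

text \<open>The valuation v need not be normalised: for q inert or ramified it is the q-adic valuation
  of the norm, so that e = 2 in both cases.\<close>
definition is_place :: "int \<Rightarrow> nat \<Rightarrow> complex set \<Rightarrow> (complex \<Rightarrow> nat) \<Rightarrow> bool" where
  "is_place q e P v \<longleftrightarrow> P \<in> primes_of K \<and>
     (\<forall>a\<in>Zw - {0}. \<forall>b\<in>Zw - {0}. v (a * b) = v a + v b) \<and>
     (\<forall>a\<in>Zw - P. v a = 0) \<and> (\<forall>k. k \<noteq> 0 \<longrightarrow> v (of_int k) = e * multiplicity q k)"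

text \<open>Primality of the set of elements with norm divisible by q follows from multiplicativity
  of the norm. Only closure under addition distinguishes ramified and inert primes from split
  ones.\<close>

lemma nonsplit_place:
  assumes q: "prime q"
    and add: "\<And>a b. a \<in> Zw \<Longrightarrow> b \<in> Zw \<Longrightarrow> q dvd nrm a \<Longrightarrow> q dvd nrm b \<Longrightarrow> q dvd nrm (a + b)"
  shows "is_place q 2 {z \<in> Zw. q dvd nrm z} (\<lambda>z. multiplicity q (nrm z))"
  unfolding is_place_def
proof (intro conjI ballI allI impI)
  show "{z \<in> Zw. q dvd nrm z} \<in> primes_of K"
  proof (rule primes_ofI)
    show "of_int q \<in> {z \<in> Zw. q dvd nrm z}" by (simp add: power2_eq_square)
    show "1 \<notin> {z \<in> Zw. q dvd nrm z}" using q by auto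
    show "of_int q \<noteq> (0::complex)" using q by auto
  qed (use add q in \<open>auto simp: nrm_mult prime_dvd_mult_iff\<close>)
  show "multiplicity q (nrm (a * b)) = multiplicity q (nrm a) + multiplicity q (nrm b)"
    if "a \<in> Zw - {0}" "b \<in> Zw - {0}" for a b
    using that q by (simp add: nrm_mult multiplicity_mult_prime nrm_eq_0_iff)
  show "multiplicity q (nrm a) = 0" if "a \<in> Zw - {z \<in> Zw. q dvd nrm z}" for a
    using that by (simp add: not_dvd_imp_multiplicity_0)
  show "multiplicity q (nrm (of_int k)) = 2 * multiplicity q k" if "k \<noteq> 0" for k
    using that q by (simp add: multiplicity_power_prime)
qed

text \<open>Substitution of the integer r for w. Modulo m it is a ring homomorphism as soon as r is
  a root of X^2 - t*X + n modulo m.\<close>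

definition ev :: "int \<Rightarrow> complex \<Rightarrow> int" where
  "ev r z = (THE k. \<exists>x y. z = el x y \<and> k = x + y * r)"

lemma ev_el [simp]: "ev r (el x y) = x + y * r"
  unfolding ev_def by (rule the_equality) auto

lemma ev_of_int [simp]: "ev r (of_int k) = k" "ev r 1 = 1"
  using ev_el[of r k 0] ev_el[of r 1 0] by (simp_all add: el_def)

lemma ev_add: "a \<in> Zw \<Longrightarrow> b \<in> Zw \<Longrightarrow> ev r (a + b) = ev r a + ev r b"
  by (elim el_cases) (simp add: el_add algebra_simps)

lemma ev_mult:
  assumes "a \<in> Zw" "b \<in> Zw" "m dvd r^2 - t*r + n"
  shows "m dvd ev r (a * b) - ev r a * ev r b"
proof -
  from assms obtain x y x' y' where ab: "a = el x y" "b = el x' y'" by (metis el_cases)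
  have "ev r (a * b) - ev r a * ev r b = (r^2 - t*r + n) * (- y*y')"
    unfolding ab el_mult ev_el by (simp add: power2_eq_square algebra_simps)
  then show ?thesis using assms(3) by simp
qed

text \<open>The other root is t - r, so the two evaluations play the role of z and its
  conjugate.\<close>

lemma ev_nrm:
  assumes "z \<in> Zw" "m dvd r^2 - t*r + n"
  shows "m dvd ev r z * ev (t - r) z - nrm z"
proof -
  from assms obtain x y where z: "z = el x y" by (metis el_cases)
  have "ev r z * ev (t - r) z - nrm z = (r^2 - t*r + n) * (- y*y)"
    unfolding z nrm_el ev_el by (simp add: power2_eq_square algebra_simps)
  then show ?thesis using assms(2) by simp
qed

text \<open>v is the q-adic valuation after the embedding that sends w to the root approximated by
  R. It cannot exceed the valuation of the norm, so a precision one above the latter determines it.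
  The complementary term in the second claim belongs to the conjugate place.\<close>

lemma split_place:
  assumes q: "prime q"
    and root: "\<And>k. q ^ k dvd R k ^ 2 - t * R k + n" and near: "\<And>k. q dvd R k - r"
    and coh: "\<And>k l. k \<le> l \<Longrightarrow> q ^ k dvd R l - R k"
  defines "v \<equiv> (\<lambda>z. multiplicity q (ev (R (Suc (multiplicity q (nrm z)))) z))"
  shows "is_place q 1 {z \<in> Zw. q dvd ev r z} v"
    and "\<And>z. z \<in> Zw \<Longrightarrow> z \<noteq> 0 \<Longrightarrow>
      v z + multiplicity q (ev (t - R (Suc (multiplicity q (nrm z)))) z) = multiplicity q (nrm z)"
proof -
  have prod: "ev (R k) z \<noteq> 0 \<and> 
      multiplicity q (ev (R k) z) + multiplicity q (ev (t - R k) z) = multiplicity q (nrm z)"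
    if "z \<in> Zw" "z \<noteq> 0" "multiplicity q (nrm z) < k" for z k
  proof -
    have "nrm z \<noteq> 0" using that by (simp add: nrm_eq_0_iff)
    from multiplicity_cong_power[OF q ev_nrm[OF that(1) root] this that(3)]
    have "ev (R k) z * ev (t - R k) z \<noteq> 0"
      "multiplicity q (ev (R k) z * ev (t - R k) z) = multiplicity q (nrm z)" by auto
    then show ?thesis using q by (simp add: multiplicity_mult_prime)
  qed
  show "v z + multiplicity q (ev (t - R (Suc (multiplicity q (nrm z)))) z) = multiplicity q (nrm z)"
    if "z \<in> Zw" "z \<noteq> 0" for z
    using prod[OF that, of "Suc (multiplicity q (nrm z))"] unfolding v_def by simp
  \<comment> \<open>Any larger precision gives the same value, so different elements can be compared
    at a common one.\<close>
  have stable: "multiplicity q (ev (R k) z) = v z" 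
    if z: "z \<in> Zw" "z \<noteq> 0" and k: "multiplicity q (nrm z) < k" for z k
  proof -
    let ?j = "Suc (multiplicity q (nrm z))"
    from z obtain x y where zxy: "z = el x y" by (metis el_cases)
    have "ev (R k) z - ev (R ?j) z = (R k - R ?j) * y" unfolding zxy by (simp add: algebra_simps)
    then have "q ^ ?j dvd ev (R k) z - ev (R ?j) z" using coh[of ?j k] k by (simp del: power_Suc)
    moreover have "ev (R ?j) z \<noteq> 0" "multiplicity q (ev (R ?j) z) < ?j"
      using prod[OF z, of ?j] by auto
    ultimately show ?thesis using multiplicity_cong_power[OF q] unfolding v_def by blast
  qed
  have rr: "q dvd r^2 - t*r + n"
  proof -
    have "q dvd R 1 ^ 2 - t * R 1 + n" using root[of 1] by simp
    moreover have "R 1 ^ 2 - t * R 1 + n - (r^2 - t*r + n) = (R 1 - r) * (R 1 + r - t)"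
      by (simp add: power2_eq_square algebra_simps)
    then have "q dvd R 1 ^ 2 - t * R 1 + n - (r^2 - t*r + n)" using near by simp
    ultimately have "q dvd (R 1 ^ 2 - t * R 1 + n) - (R 1 ^ 2 - t * R 1 + n - (r^2 - t*r + n))"
      by (rule dvd_diff)
    then show ?thesis by (simp add: algebra_simps)
  qed
  have evm: "q dvd ev r (a * b) \<longleftrightarrow> q dvd ev r a \<or> q dvd ev r b" if "a \<in> Zw" "b \<in> Zw" for a b
  proof -
    have "q dvd ev r (a * b) \<longleftrightarrow> q dvd ev r a * ev r b"
      using ev_mult[OF that rr] by (metis dvd_diff_left_iff dvd_diff_right_iff)
    then show ?thesis using q by (simp add: prime_dvd_mult_iff)
  qed
  show "is_place q 1 {z \<in> Zw. q dvd ev r z} v"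
    unfolding is_place_def
  proof (intro conjI ballI allI impI)
    show "{z \<in> Zw. q dvd ev r z} \<in> primes_of K"
    proof (rule primes_ofI)
      show "of_int q \<in> {z \<in> Zw. q dvd ev r z}" by simp
      show "1 \<notin> {z \<in> Zw. q dvd ev r z}" using q by auto
      show "of_int q \<noteq> (0::complex)" using q by auto
    qed (auto simp: evm ev_add)
    show "v (a * b) = v a + v b" if ab: "a \<in> Zw - {0}" "b \<in> Zw - {0}" for a b
    proof -
      \<comment> \<open>This precision serves a, b and a * b at once.\<close>
      define k where "k = Suc (multiplicity q (nrm (a * b)))"
      have z: "a \<in> Zw" "b \<in> Zw" "a \<noteq> 0" "b \<noteq> 0" "a * b \<in> Zw" "a * b \<noteq> 0" using ab by auto
      have "multiplicity q (nrm (a * b)) = multiplicity q (nrm a) + multiplicity q (nrm b)"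
        using z q by (simp add: nrm_mult multiplicity_mult_prime nrm_eq_0_iff)
      then have k: "multiplicity q (nrm a) < k" "multiplicity q (nrm b) < k"
        "multiplicity q (nrm (a * b)) < k" "multiplicity q (nrm a) + multiplicity q (nrm b) < k"
        unfolding k_def by auto
      note pa = prod[OF z(1,3) k(1)] and pb = prod[OF z(2,4) k(2)]
      have m: "multiplicity q (ev (R k) a * ev (R k) b) = v a + v b"
        using pa pb stable[OF z(1,3) k(1)] stable[OF z(2,4) k(2)] q
        by (simp add: multiplicity_mult_prime)
      also have "\<dots> < k"
        using pa pb k(4) stable[OF z(1,3) k(1)] stable[OF z(2,4) k(2)] by linarith
      finally have "multiplicity q (ev (R k) a * ev (R k) b) < k" .
      from multiplicity_cong_power[OF q ev_mult[OF z(1,2) root] _ this] pa pb m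
      have "multiplicity q (ev (R k) (a * b)) = v a + v b" by simp
      then show ?thesis using stable[OF z(5,6) k(3)] by simp
    qed
    show "v a = 0" if a: "a \<in> Zw - {z \<in> Zw. q dvd ev r z}" for a
    proof -
      from a obtain x y where xy: "a = el x y" by (metis DiffD1 el_cases)
      let ?j = "Suc (multiplicity q (nrm a))"
      have "ev (R ?j) a - ev r a = (R ?j - r) * y" unfolding xy by (simp add: algebra_simps)
      then have "q dvd ev (R ?j) a - ev r a" using near by simp
      then have "\<not> q dvd ev (R ?j) a" using a
        by (metis (mono_tags, lifting) DiffE mem_Collect_eq dvd_diff_right_iff)
      then show ?thesis unfolding v_def by (rule not_dvd_imp_multiplicity_0)
    qed
    show "v (of_int k) = 1 * multiplicity q k" if "k \<noteq> 0" for k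
      by (simp add: v_def)
  qed
qed

text \<open>When q divides the discriminant, divisibility of the norm form by q is divisibility of a
  linear form, and linear forms are additive.\<close>

lemma ramified_place:
  assumes q: "prime q" and disc: "q dvd t^2 - 4*n"
  shows "is_place q 2 {z \<in> Zw. q dvd nrm z} (\<lambda>z. multiplicity q (nrm z))"
proof (rule nonsplit_place[OF q])
  \<comment> \<open>For odd q this comes from completing the square. For q = 2 the trace t is even,
    and x^2 + n*y^2 is congruent to x + n*y modulo 2.\<close>
  define l where "l x y = (if q = 2 then x + n*y else 2*x + t*y)" for x y
  have nrm_iff: "q dvd nrm (el x y) \<longleftrightarrow> q dvd l x y" for x y
  proof (cases "q = 2")
    case True
    with disc have "even t" by simp
    with True show ?thesis by (simp add: l_def) 
  next
    case False
    then have "\<not> q dvd 2" using q primes_dvd_imp_eq[of q 2] by auto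
    then have "\<not> q dvd 2^2" using q prime_dvd_power by blast
    then have "q dvd nrm (el x y) \<longleftrightarrow> q dvd 4 * nrm (el x y)" using prime_dvd_mult_iff[OF q, of 4 "nrm (el x y)"] by (simp del: nrm_el)
    also have "4 * nrm (el x y) = (2*x+t*y)^2 - (t^2-4*n)*y^2"
      by (simp add: power2_eq_square algebra_simps)
    also have "q dvd \<dots> \<longleftrightarrow> q dvd (2*x+t*y)^2"
      using disc by (metis dvd_diff_left_iff dvd_mult2)
    also have "\<dots> \<longleftrightarrow> q dvd 2*x+t*y" using q by (simp add: prime_dvd_power_iff)
    finally show ?thesis using False by (simp add: l_def)
  qed
  show "q dvd nrm (a + b)" if ab: "a \<in> Zw" "b \<in> Zw" "q dvd nrm a" "q dvd nrm b" for a b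
  proof -
    from ab obtain x y x' y' where xy: "a = el x y" "b = el x' y'" by (metis el_cases)
    have "l (x+x') (y+y') = l x y + l x' y'" by (simp add: l_def algebra_simps)
    then show ?thesis using ab unfolding xy el_add nrm_iff by simp
  qed
qed

text \<open>Without a root of X^2 - t*X + n modulo q the norm form is anisotropic there: q divides a
  norm only if it divides both coordinates. Dividing by q then lowers the valuation of the norm by
  2.\<close>

lemma inert_place:
  assumes q: "prime q" and nr: "\<And>r. \<not> q dvd r^2 - t*r + n"
  shows "is_place q 2 {z \<in> Zw. q dvd nrm z} (\<lambda>z. multiplicity q (nrm z))"
    and "z \<in> Zw \<Longrightarrow> z \<noteq> 0 \<Longrightarrow> even (multiplicity q (nrm z))"
proof -
  have nrm_iff: "q dvd nrm (el x y) \<longleftrightarrow> q dvd x \<and> q dvd y" for x y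
  proof
    assume d: "q dvd nrm (el x y)"
    have y: "q dvd y"
    proof (rule ccontr)
      assume "\<not> q dvd y"
      with q have "coprime q y" by (rule prime_imp_coprime)
      then obtain a b where ab: "a*q + b*y = 1" by (metis coprime_iff_gcd_eq_1 bezout_int)
      \<comment> \<open>Since b inverts y modulo q, this is -x/y, which would be a root.\<close>
      define r where "r = - x * b"
      have "r^2 - t*r + n = b^2 * nrm (el x y) + (1 - b*y) * (t*x*b + n*(1 + b*y))"
        unfolding r_def by (simp add: power2_eq_square algebra_simps)
      also have "1 - b*y = a*q" using ab by simp
      finally have "q dvd r^2 - t*r + n" using d by simp
      with nr show False by blast
    qed
    have "x^2 = nrm (el x y) - y*(t*x+n*y)" by (simp add: power2_eq_square algebra_simps)
    then have "q dvd x^2" using d y by (metis dvd_diff dvd_mult2)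
    then show "q dvd x \<and> q dvd y" using q y prime_dvd_power by blast
  qed (simp add: power2_eq_square)
  show "is_place q 2 {z \<in> Zw. q dvd nrm z} (\<lambda>z. multiplicity q (nrm z))"
  proof (rule nonsplit_place[OF q])
    show "q dvd nrm (a + b)" if ab: "a \<in> Zw" "b \<in> Zw" "q dvd nrm a" "q dvd nrm b" for a b
    proof -
      from ab obtain x y x' y' where xy: "a = el x y" "b = el x' y'" by (metis el_cases)
      show ?thesis using ab unfolding xy el_add nrm_iff by simp
    qed
  qed
  show "even (multiplicity q (nrm z))" if "z \<in> Zw" "z \<noteq> 0"
    using that
  proof (induction "multiplicity q (nrm z)" arbitrary: z rule: less_induct)
    case less
    show ?case
    proof (cases "q dvd nrm z")
      case False
      then show ?thesis by (simp add: not_dvd_imp_multiplicity_0)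
    next
      case True
      obtain x y where xy: "z = el x y" using less.prems by (metis el_cases)
      then obtain x' y' where xy': "x = q * x'" "y = q * y'" using True nrm_iff by (metis dvdE)
      define z' where "z' = el x' y'"
      have z: "z = of_int q * z'" unfolding xy xy' z'_def by (simp add: el_def algebra_simps)
      have z': "z' \<in> Zw" "z' \<noteq> 0" using less.prems z by (auto simp: z'_def)
      have "nrm z = q^2 * nrm z'" unfolding z using z' by (simp add: nrm_mult)
      moreover have "nrm z' \<noteq> 0" using z' by (simp add: nrm_eq_0_iff)
      ultimately have m: "multiplicity q (nrm z) = 2 + multiplicity q (nrm z')" 
        using q multiplicity_self[of q] by (auto simp: multiplicity_mult_prime multiplicity_power_prime)
      with less.hyps[OF _ z'] show ?thesis by simp
    qed
  qed
qed

text \<open>A split prime comes with both of its places, because only the sum of their valuations is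
  the valuation of the norm.\<close>

lemma place_cases [consumes 1]:
  assumes q: "prime q"
  obtains (nonsplit) P where "is_place q 2 P (\<lambda>z. multiplicity q (nrm z))"
      "\<And>z. \<not> q dvd t^2 - 4*n \<Longrightarrow> z \<in> Zw \<Longrightarrow> z \<noteq> 0 \<Longrightarrow> even (multiplicity q (nrm z))"
  | (split) P v P' v' where "is_place q 1 P v" "is_place q 1 P' v'"
      "\<And>z. z \<in> Zw \<Longrightarrow> z \<noteq> 0 \<Longrightarrow> v z + v' z = multiplicity q (nrm z)"
proof (cases "q dvd t^2 - 4*n")
  case True
  show ?thesis by (rule nonsplit[OF ramified_place[OF q True]]) (use True in simp)
next
  case ur: False
  show ?thesis
  proof (cases "\<exists>r. q dvd r^2 - t*r + n")
    case False
    then have nr: "\<not> q dvd r^2 - t*r + n" for r by blast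
    show ?thesis by (rule nonsplit[OF inert_place(1)[OF q nr] inert_place(2)[OF q nr]])
  next
    case True
    then obtain r where r: "q dvd r^2 - t*r + n" by blast
    have "\<not> q dvd 2*r - t"
    proof
      assume "q dvd 2*r - t"
      \<comment> \<open>The discriminant is the squared derivative minus four times the value, so a
        double root modulo q would make q ramified.\<close>
      then have "q dvd (2*r-t)*(2*r-t) - 4 * (r^2 - t*r + n)" using r by (meson dvd_diff dvd_mult dvd_mult2)
      also have "\<dots> = t^2 - 4*n" by (simp add: power2_eq_square algebra_simps)
      finally show False using ur by simp
    qed
    from hensel_quadratic[OF q r this] obtain R where R: "\<And>k. q ^ k dvd R k ^ 2 - t * R k + n"
      "\<And>k. q dvd R k - r" "\<And>k l. k \<le> l \<Longrightarrow> q ^ k dvd R l - R k" by blast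
    define R' where "R' k = t - R k" for k
    have R': "q ^ k dvd R' k ^ 2 - t * R' k + n" "q dvd R' k - (t - r)" for k
    proof -
      have "R' k ^ 2 - t * R' k + n = R k ^ 2 - t * R k + n" "R' k - (t - r) = - (R k - r)"
        unfolding R'_def by (simp_all add: power2_eq_square algebra_simps)
      then show "q ^ k dvd R' k ^ 2 - t * R' k + n" "q dvd R' k - (t - r)" 
        using R(1,2) by (simp, metis dvd_minus_iff)
    qed
    have R'3: "q ^ k dvd R' l - R' k" if "k \<le> l" for k l
    proof -
      have "R' l - R' k = - (R l - R k)" unfolding R'_def by simp
      then show ?thesis using R(3)[OF that] by (metis dvd_minus_iff)
    qed
    have sum: "multiplicity q (ev (R (Suc (multiplicity q (nrm z)))) z) +
        multiplicity q (ev (R' (Suc (multiplicity q (nrm z)))) z) = multiplicity q (nrm z)"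
      if "z \<in> Zw" "z \<noteq> 0" for z
      using split_place(2)[OF q R that] unfolding R'_def by simp
    show ?thesis by (rule split[OF split_place(1)[OF q R] split_place(1)[OF q R' R'3] sum])
  qed
qed

end

subsection \<open>Reduction at 2\<close>

text \<open>This invariant enters through j - 1728 = c6^2 / Delta.\<close>

fun wc6 :: "weierstrass \<Rightarrow> complex" where
  "wc6 (a1,a2,a3,a4,a6) =
    (let b2 = a1^2 + 4*a2; b4 = 2*a4 + a1*a3; b6 = a3^2 + 4*a6
     in - (b2^3) + 36*b2*b4 - 216*b6)"

declare wdisc.simps [simp del] wc4.simps [simp del] wc6.simps [simp del]

lemma wc4_wc6_wdisc: "wc4 E ^ 3 - wc6 E ^ 2 = 1728 * wdisc E"
proof -
  obtain a1 a2 a3 a4 a6 where E: "E = (a1,a2,a3,a4,a6)" by (metis prod_cases5)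
  define b2 b4 b6 b8 where b: "b2 = a1^2 + 4*a2" "b4 = 2*a4 + a1*a3" "b6 = a3^2 + 4*a6"
    "b8 = a1^2*a6 + 4*a2*a6 - a1*a3*a4 + a2*a3^2 - a4^2"
  \<comment> \<open>The identity below holds only modulo this relation among the b's, which is used
    to eliminate b8.\<close>
  have "4*b8 = b2*b6 - b4^2" unfolding b by (simp add: power2_eq_square algebra_simps)
  then have b8: "b8 = (b2*b6 - b4^2) / 4" by (simp add: eq_divide_eq mult.commute)
  have "(b2^2 - 24*b4)^3 - (- (b2^3) + 36*b2*b4 - 216*b6)^2 =
    1728 * ((- (b2^2*b8)) - 8*b4^3 - 27*b6^2 + 9*b2*b4*b6)"
    unfolding b8 by (simp add: power2_eq_square power3_eq_cube field_simps)
  then show ?thesis unfolding E b by (simp only: wc4.simps wc6.simps wdisc.simps Let_def)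
qed

context quad_ring begin

lemma nrm_add_even: 
  assumes "z \<in> Zw" "y \<in> Zw" shows "odd (nrm (z + 2 * y)) \<longleftrightarrow> odd (nrm z)"
proof -
  obtain B where "nrm (z + of_int 2 * y) = nrm z + 2 * B + 2^2 * nrm y"
    using nrm_add_scaled[OF assms] by blast
  then show ?thesis by simp
qed

text \<open>The norm of the square is 1 modulo 8; the cross term is four times a trace, which
  vanishes modulo 8 once traces are even.\<close>

lemma nrm_square_add_4:
  assumes "h \<in> Zw" "y \<in> Zw" "odd (nrm h)"
  shows "nrm (h^2 + 4*y) mod 4 = 1" "even t \<Longrightarrow> nrm (h^2 + 4*y) mod 8 = 1"
proof -
  obtain B where B: "nrm (h^2 + of_int 4 * y) = nrm (h^2) + 4 * B + 4^2 * nrm y" "even t \<Longrightarrow> even B"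
    using nrm_add_scaled[of "h^2" y 4] assms by blast
  have h: "(nrm h)^2 mod 8 = 1" using assms(3) by (rule odd_square_mod_8)
  define s where "s = (nrm h)^2"
  have eq: "nrm (h^2 + 4*y) = s + 4 * B + 16 * nrm y" using B assms by (simp add: nrm_power s_def)
  show "nrm (h^2 + 4*y) mod 4 = 1" unfolding eq using h[folded s_def] by presburger
  show "nrm (h^2 + 4*y) mod 8 = 1" if "even t" 
    unfolding eq using h[folded s_def] B(2)[OF that] by presburger
qed

text \<open>Modulo 4, -c6 is the square of a1^3, and modulo 2, c4 is a1^4. The sign of c6 disappears
  in a norm of degree 2.\<close>

lemma reduction_ordinary:
  assumes "a1 \<in> Zw" "a2 \<in> Zw" "a3 \<in> Zw" "a4 \<in> Zw" "a6 \<in> Zw" "odd (nrm a1)"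
  shows "odd (nrm (wc4 (a1,a2,a3,a4,a6)))" "nrm (wc6 (a1,a2,a3,a4,a6)) mod 4 = 1"
    "even t \<Longrightarrow> nrm (wc6 (a1,a2,a3,a4,a6)) mod 8 = 1"
proof -
  \<comment> \<open>The quotient of -c6 - a1^6 by 4.\<close>
  define y where "y = 3*a1^4*a2 + 12*a1^2*a2^2 + 16*a2^3 - 9*(a1^2+4*a2)*(2*a4+a1*a3) + 54*(a3^2+4*a6)"
  have y: "y \<in> Zw" unfolding y_def using assms by simp
  have c6: "wc6 (a1,a2,a3,a4,a6) = - ((a1^3)^2 + 4*y)"
    unfolding y_def wc6.simps Let_def by (simp add: power2_eq_square power3_eq_cube power4_eq_xxxx algebra_simps)
  have n6: "nrm (wc6 (a1,a2,a3,a4,a6)) = nrm ((a1^3)^2 + 4*y)" 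
    unfolding c6 by (rule nrm_uminus) (use assms y in simp)
  have "odd (nrm (a1^3))" using assms by (simp add: nrm_power)
  then show "nrm (wc6 (a1,a2,a3,a4,a6)) mod 4 = 1" "even t \<Longrightarrow> nrm (wc6 (a1,a2,a3,a4,a6)) mod 8 = 1"
    using nrm_square_add_4[of "a1^3" y] y assms unfolding n6 by blast+
  have "wc4 (a1,a2,a3,a4,a6) = a1^4 + 2 * (4*a1^2*a2 + 8*a2^2 - 12*(2*a4 + a1*a3))"
    unfolding wc4.simps Let_def by (simp add: power2_eq_square power4_eq_xxxx algebra_simps)
  then have "odd (nrm (wc4 (a1,a2,a3,a4,a6))) \<longleftrightarrow> odd (nrm (a1^4))"
    by (simp only:) (rule nrm_add_even, use assms in simp_all)
  then show "odd (nrm (wc4 (a1,a2,a3,a4,a6)))" using assms by (simp add: nrm_power)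
qed

text \<open>When 2 divides b2, the discriminant is congruent to -27*b6^2, hence to a3^4, modulo
  2.\<close>

lemma reduction_odd_a3:
  assumes "a1 \<in> Zw" "a2 \<in> Zw" "a3 \<in> Zw" "a4 \<in> Zw" "a6 \<in> Zw" "\<beta> \<in> Zw" "a1^2 + 4*a2 = 2*\<beta>"
    and "odd (nrm (wdisc (a1,a2,a3,a4,a6)))"
  shows "odd (nrm a3)"
proof -
  define b4 b6 b8 where b: "b4 = 2*a4 + a1*a3" "b6 = a3^2 + 4*a6"
    "b8 = a1^2*a6 + 4*a2*a6 - a1*a3*a4 + a2*a3^2 - a4^2"
  have bin: "b4 \<in> Zw" "b6 \<in> Zw" "b8 \<in> Zw" unfolding b using assms by simp_all
  have "wdisc (a1,a2,a3,a4,a6) = - ((2*\<beta>)^2*b8) - 8*b4^3 - 27*b6^2 + 9*(2*\<beta>)*b4*b6"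
    unfolding wdisc.simps Let_def assms(7) b ..
  also have "27*b6^2 = - (a3^4) + 2*(14*a3^4 + 108*a3^2*a6 + 216*a6^2)"
    unfolding b by (simp add: power2_eq_square power4_eq_xxxx algebra_simps)
  also have "- ((2*\<beta>)^2*b8) - 8*b4^3 - (- (a3^4) + 2*(14*a3^4 + 108*a3^2*a6 + 216*a6^2)) + 9*(2*\<beta>)*b4*b6
    = a3^4 + 2*(9*\<beta>*b4*b6 - 2*\<beta>^2*b8 - 4*b4^3 - (14*a3^4 + 108*a3^2*a6 + 216*a6^2))"
    by (simp add: power2_eq_square algebra_simps)
  finally have "odd (nrm (wdisc (a1,a2,a3,a4,a6))) \<longleftrightarrow> odd (nrm (a3^4))"
    by (simp only:) (rule nrm_add_even, use assms bin in simp_all)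
  then show ?thesis using assms by (simp add: nrm_power)
qed

lemma reduction_supersingular:
  assumes "\<alpha> \<in> Zw" "a2 \<in> Zw" "a3 \<in> Zw" "a4 \<in> Zw" "a6 \<in> Zw"
    and "odd (nrm (wdisc (2*\<alpha>,a2,a3,a4,a6)))"
  obtains h k where "nrm (wc4 (2*\<alpha>,a2,a3,a4,a6)) = 256 * k" "nrm (wc6 (2*\<alpha>,a2,a3,a4,a6)) = 64 * h"
    "h mod 4 = 1" "even t \<Longrightarrow> h mod 8 = 1"
proof -
  have "(2*\<alpha>)^2 + 4*a2 = 2 * (2*\<alpha>^2 + 2*a2)" by (simp add: power2_eq_square)
  from reduction_odd_a3[OF _ assms(2-5) _ this assms(6)] have a3: "odd (nrm a3)" using assms by simp
  \<comment> \<open>Here b2 = 4*c and b4 = 2*d, which gives the factors 16 of c4 and 8 of c6. What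
    remains of c6 is congruent to the square of a3 modulo 4.\<close>
  define c d where cd: "c = \<alpha>^2 + a2" "d = a4 + \<alpha>*a3"
  have cdin: "c \<in> Zw" "d \<in> Zw" unfolding cd using assms by simp_all
  define y where "y = 9*c*d - 2*c^3 - 7*a3^2 - 27*a6"
  have y: "y \<in> Zw" unfolding y_def using assms cdin by simp
  have "wc4 (2*\<alpha>,a2,a3,a4,a6) = 16 * (c^2 - 3*d)"
    unfolding wc4.simps Let_def cd by (simp add: power2_eq_square algebra_simps)
  then have 1: "nrm (wc4 (2*\<alpha>,a2,a3,a4,a6)) = 256 * nrm (c^2 - 3*d)"
    using cdin nrm_mult[of 16 "c^2 - 3*d"] by simp
  have "wc6 (2*\<alpha>,a2,a3,a4,a6) = 8 * (a3^2 + 4*y)"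
    unfolding wc6.simps Let_def y_def cd by (simp add: power2_eq_square power3_eq_cube algebra_simps)
  then have 2: "nrm (wc6 (2*\<alpha>,a2,a3,a4,a6)) = 64 * nrm (a3^2 + 4*y)"
    using y assms nrm_mult[of 8 "a3^2 + 4*y"] by simp
  show ?thesis using that[OF 1 2] nrm_square_add_4[OF assms(3) y a3] by blast
qed

text \<open>For odd t and n the norm form is x^2 + x*y + y^2 modulo 2, so an a1 of even norm is
  twice an element of the ring.\<close>

lemma reduction_at_inert_2:
  assumes "odd t" "odd n" and a: "a1 \<in> Zw" "a2 \<in> Zw" "a3 \<in> Zw" "a4 \<in> Zw" "a6 \<in> Zw"
    and disc: "odd (nrm (wdisc (a1,a2,a3,a4,a6)))"
  obtains (ordinary) "odd (nrm (wc4 (a1,a2,a3,a4,a6)))" "nrm (wc6 (a1,a2,a3,a4,a6)) mod 4 = 1"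
  | (supersingular) h k where "nrm (wc4 (a1,a2,a3,a4,a6)) = 256 * k"
      "nrm (wc6 (a1,a2,a3,a4,a6)) = 64 * h" "h mod 4 = 1"
proof (cases "odd (nrm a1)")
  case True
  with ordinary reduction_ordinary[OF a] show ?thesis by blast
next
  case False
  from a obtain x y where xy: "a1 = el x y" by (metis el_cases)
  have "even x" "even y" using False assms(1,2) unfolding xy by auto
  then obtain x' y' where xy': "x = 2*x'" "y = 2*y'" by (metis evenE)
  have "a1 = 2 * el x' y'" unfolding xy xy' by (simp add: el_def algebra_simps)
  with supersingular reduction_supersingular[of "el x' y'"] a disc show ?thesis by (metis el_in)
qed

text \<open>The outcomes correspond to valuation 0, at least 2, and exactly 1 of a1 at the prime
  above 2. In the last case a1 has two odd coordinates.\<close>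

lemma reduction_at_ramified_2:
  assumes "t = 0" "n mod 8 = 5" and a: "a1 \<in> Zw" "a2 \<in> Zw" "a3 \<in> Zw" "a4 \<in> Zw" "a6 \<in> Zw"
    and disc: "odd (nrm (wdisc (a1,a2,a3,a4,a6)))"
  obtains (ordinary) "odd (nrm (wc4 (a1,a2,a3,a4,a6)))" "nrm (wc6 (a1,a2,a3,a4,a6)) mod 8 = 1"
  | (supersingular) h k where "nrm (wc4 (a1,a2,a3,a4,a6)) = 256 * k"
      "nrm (wc6 (a1,a2,a3,a4,a6)) = 64 * h" "h mod 8 = 1"
  | (mixed) h where "nrm (wc4 (a1,a2,a3,a4,a6)) = 16 * h" "h mod 8 = 5"
proof -
  have et: "even t" using assms(1) by simp
  have oddn: "odd n" using assms(2) by presburger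
  have nrm0: "nrm (el x y) = x^2 + n*y^2" for x y by (rule nrm_el[THEN trans]) (simp add: assms(1))
  have mult0: "el x y * el u v = el (x*u - n*y*v) (x*v + y*u)" for x y u v
    unfolding el_mult assms(1) by simp
  show ?thesis
  proof (cases "odd (nrm a1)")
    case True
    with ordinary reduction_ordinary[OF a] et show ?thesis by blast
  next
    case False
    from a obtain x y where xy: "a1 = el x y" by (metis el_cases)
    have par: "even x \<longleftrightarrow> even y" using False oddn unfolding xy nrm0 by auto
    show ?thesis
    proof (cases "even x")
      case True
      then obtain x' y' where xy': "x = 2*x'" "y = 2*y'" using par by (metis evenE)
      have a1: "a1 = 2 * el x' y'" unfolding xy xy' by (simp add: el_def algebra_simps)
      obtain h k where "nrm (wc4 (a1,a2,a3,a4,a6)) = 256 * k"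
        "nrm (wc6 (a1,a2,a3,a4,a6)) = 64 * h" "h mod 8 = 1"
        using reduction_supersingular[of "el x' y'"] a disc et unfolding a1 by (metis el_in)
      then show ?thesis by (rule supersingular)
    next
      case False
      then have odd: "odd x" "odd y" using par by auto
      have sq: "x^2 mod 8 = 1" "y^2 mod 8 = 1" using odd by (simp_all add: odd_square_mod_8)
      obtain j where j: "n = 8*j + 5" using assms(2) by (metis mult_div_mod_eq)
      obtain i where i: "y^2 = 8*i + 1" using sq(2) by (metis mult_div_mod_eq)
      obtain i' where i': "x^2 = 8*i' + 1" using sq(1) by (metis mult_div_mod_eq)
      \<comment> \<open>Half of x^2 - n*y^2, which is 4 modulo 8. Thus a1^2 is twice an element with
        even first and odd second coordinate.\<close>
      define m where "m = 4*i' - 4*j*y^2 - 20*i - 2"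
      have m2: "x^2 - n*y^2 = 2*m" "even m" unfolding m_def i i' j by (simp_all add: algebra_simps)
      have a1sq: "a1^2 = el (2*m) (2*(x*y))"
        using m2(1) unfolding xy power2_eq_square mult0 by simp
      define \<beta> where "\<beta> = el m (x*y) + 2*a2"
      have \<beta>in: "\<beta> \<in> Zw" unfolding \<beta>_def using a by simp
      have b2: "a1^2 + 4*a2 = 2*\<beta>" unfolding \<beta>_def a1sq by (simp add: el_def algebra_simps)
      have a3: "odd (nrm a3)" by (rule reduction_odd_a3[OF a \<beta>in b2 disc])
      from a obtain a2x a2y where a2xy: "a2 = el a2x a2y" by (metis el_cases)
      define b c where bc: "b = m + 2*a2x" "c = x*y + 2*a2y"
      have \<beta>: "\<beta> = el b c" unfolding \<beta>_def a2xy bc by (simp add: el_def algebra_simps)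
      have parbc: "even b" "odd c" unfolding bc using m2(2) odd by simp_all
      from a obtain u v where uv: "a1 * a3 = el u v" by (metis el_cases Zw_mult)
      have "x^2 + n*y^2 = 8*i' + 8*(j*y^2) + 40*i + 6" unfolding i' j by (simp add: i algebra_simps)
      then have na1: "nrm a1 = 8*i' + 8*(j*y^2) + 40*i + 6" unfolding xy nrm0 .
      have "nrm (a1 * a3) = (8*i' + 8*(j*y^2) + 40*i + 6) * nrm a3"
        unfolding nrm_mult[OF a(1,3)] na1 ..
      then have nuv: "u^2 + n*v^2 = (8*i' + 8*(j*y^2) + 40*i + 6) * nrm a3" unfolding uv nrm0 .
      \<comment> \<open>The norm of a1 is 6 modulo 8 and that of a3 is odd, so 2 divides the norm of
        a1 * a3 exactly once.\<close>
      have parv: "odd u" "odd v"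
      proof -
        have "even (u^2 + n*v^2)" unfolding nuv by simp
        then have "even u \<longleftrightarrow> even v" using oddn by simp
        moreover have "\<not> (even u \<and> even v)"
        proof
          assume "even u \<and> even v"
          then obtain u' v' where "u = 2*u'" "v = 2*v'" by (metis evenE)
          then have "2 * (2 * (u'^2 + n*v'^2)) = 2 * ((4*i' + 4*(j*y^2) + 20*i + 3) * nrm a3)"
            using nuv by (simp add: power2_eq_square algebra_simps)
          then have "2 * (u'^2 + n*v'^2) = (4*i' + 4*(j*y^2) + 20*i + 3) * nrm a3" by linarith
          then have "even ((4*i' + 4*(j*y^2) + 20*i + 3) * nrm a3)" by (metis dvd_triv_left)
          then show False using a3 by simp
        qed
        ultimately show "odd u" "odd v" by auto
      qed
      \<comment> \<open>Here c4 is 4 times beta^2 - 6*a1*a3 - 12*a4. Multiples of 4 go into y',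
        because for even t they do not affect the norm modulo 8; the norm of z is 1 + 4 modulo
        8.\<close>
      define z where "z = \<beta>^2 + 2*(a1*a3)"
      define y' where "y' = - (2*(a1*a3)) - 3*a4"
      have zin: "z \<in> Zw" "y' \<in> Zw" unfolding z_def y'_def using a \<beta>in by simp_all
      have "wc4 (a1,a2,a3,a4,a6) = 4 * (z + of_int 4 * y')"
        unfolding wc4.simps Let_def b2 z_def y'_def by (simp add: power2_eq_square algebra_simps)
      then have c4: "nrm (wc4 (a1,a2,a3,a4,a6)) = 16 * nrm (z + of_int 4 * y')"
        using zin nrm_mult[of 4 "z + of_int 4 * y'"] by simp
      obtain B where B: "nrm (z + of_int 4 * y') = nrm z + 4 * B + 4^2 * nrm y'" "even B"
        using nrm_add_scaled[OF zin, of 4] et by blast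
      define P Q where PQ: "P = b^2 - n*c^2 + 2*u" "Q = b*c + v"
      have "z = el P (2*Q)" 
        unfolding z_def \<beta> uv PQ power2_eq_square mult0 by (simp add: el_def algebra_simps)
      then have nz: "nrm z = P^2 + 4*(n*Q^2)" by (simp only: nrm0) (simp add: power2_eq_square)
      have "odd P" "odd Q" unfolding PQ using parbc parv oddn by simp_all
      then have "P^2 mod 8 = 1" "odd (n*Q^2)" using oddn by (simp_all add: odd_square_mod_8)
      then obtain k l where kl: "P^2 = 8*k + 1" "n*Q^2 = 2*l + 1" by (metis mult_div_mod_eq oddE)
      from B(2) obtain B' where B': "B = 2*B'" by (rule evenE)
      have "nrm (z + of_int 4 * y') = 5 + 8*(k + l + B' + 2*nrm y')" unfolding B(1) nz kl B' by simp
      then have "nrm (z + of_int 4 * y') mod 8 = 5" by (simp only: mod_mult_self2) simp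
      with c4 show ?thesis by (rule mixed)
    qed
  qed
qed

end

subsection \<open>Integral models\<close>

lemma change_coords_invariants:
  assumes "u \<noteq> 0"
  shows "u^4 * wc4 (change_coords u r s t E) = wc4 E"
    and "u^6 * wc6 (change_coords u r s t E) = wc6 E"
    and "u^12 * wdisc (change_coords u r s t E) = wdisc E"
proof -
  obtain a1 a2 a3 a4 a6 where E: "E = (a1,a2,a3,a4,a6)" by (metis prod_cases5)
  obtain c1 c2 c3 c4 c6 where F: "change_coords u r s t E = (c1,c2,c3,c4,c6)" by (metis prod_cases5)
  have c: "u * c1 = a1 + 2*s" "u^2 * c2 = a2 - s*a1 + 3*r - s^2" "u^3 * c3 = a3 + r*a1 + 2*t"
    "u^4 * c4 = a4 - s*a3 + 2*r*a2 - (t + r*s)*a1 + 3*r^2 - 2*s*t"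
    "u^6 * c6 = a6 + r*a4 + r^2*a2 + r^3 - t*a3 - t^2 - r*t*a1"
    using F assms unfolding E by auto
  define b2 b4 b6 where b: "b2 = a1^2 + 4*a2" "b4 = 2*a4 + a1*a3" "b6 = a3^2 + 4*a6"
  define d2 d4 d6 where d: "d2 = c1^2 + 4*c2" "d4 = 2*c4 + c1*c3" "d6 = c3^2 + 4*c6"
  have "u^2 * d2 = (u*c1)^2 + 4*(u^2*c2)" unfolding d by (simp add: algebra_simps power_mult_distrib)
  also have "\<dots> = b2 + 12*r" unfolding c b by (simp add: algebra_simps power2_eq_square)
  finally have 2: "u^2 * d2 = b2 + 12*r" .
  have "u^4 * d4 = 2*(u^4*c4) + (u*c1)*(u^3*c3)"
    unfolding d by (simp add: algebra_simps power3_eq_cube power4_eq_xxxx)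
  also have "\<dots> = b4 + r*b2 + 6*r^2" unfolding c b by (simp add: algebra_simps power2_eq_square)
  finally have 4: "u^4 * d4 = b4 + r*b2 + 6*r^2" .
  have "u^6 * d6 = (u^3*c3)^2 + 4*(u^6*c6)" unfolding d by (simp add: algebra_simps power_mult_distrib)
  also have "\<dots> = b6 + 2*r*b4 + r^2*b2 + 4*r^3"
    unfolding c b by (simp add: algebra_simps power2_eq_square power3_eq_cube)
  finally have 6: "u^6 * d6 = b6 + 2*r*b4 + r^2*b2 + 4*r^3" .
  have "u^4 * wc4 (change_coords u r s t E) = (u^2*d2)^2 - 24*(u^4*d4)"
    unfolding F wc4.simps Let_def d[symmetric] by (simp add: algebra_simps power_mult_distrib)
  also have "\<dots> = wc4 E" unfolding 2 4 E wc4.simps Let_def b[symmetric]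
    by (simp add: algebra_simps power2_eq_square)
  finally show c4: "u^4 * wc4 (change_coords u r s t E) = wc4 E" .
  have "u^6 * wc6 (change_coords u r s t E) = - ((u^2*d2)^3) + 36*(u^2*d2)*(u^4*d4) - 216*(u^6*d6)"
    unfolding F wc6.simps Let_def d[symmetric]
    by (simp add: algebra_simps power_mult_distrib flip: power_add)
  also have "\<dots> = wc6 E" unfolding 2 4 6 E wc6.simps Let_def b[symmetric]
    by (simp add: algebra_simps power2_eq_square power3_eq_cube)
  finally show c6: "u^6 * wc6 (change_coords u r s t E) = wc6 E" .
  \<comment> \<open>The weight 12 of the discriminant follows from the weights of c4 and c6, so b8
    need not be transformed.\<close>
  have "1728 * (u^12 * wdisc (change_coords u r s t E)) = u^12 * (1728 * wdisc (change_coords u r s t E))"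
    by simp
  also have "\<dots> = (u^4 * wc4 (change_coords u r s t E))^3 - (u^6 * wc6 (change_coords u r s t E))^2"
    unfolding wc4_wc6_wdisc[symmetric] by (simp add: algebra_simps power_mult_distrib)
  also have "\<dots> = 1728 * wdisc E" unfolding c4 c6 by (rule wc4_wc6_wdisc)
  finally show "u^12 * wdisc (change_coords u r s t E) = wdisc E" by simp
qed

lemma scaling_invariants:
  assumes "y \<noteq> 0"
  shows "wc4 (y*a1,y^2*a2,y^3*a3,y^4*a4,y^6*a6) = y^4 * wc4 (a1,a2,a3,a4,a6)"
    and "wc6 (y*a1,y^2*a2,y^3*a3,y^4*a4,y^6*a6) = y^6 * wc6 (a1,a2,a3,a4,a6)"
    and "wdisc (y*a1,y^2*a2,y^3*a3,y^4*a4,y^6*a6) = y^12 * wdisc (a1,a2,a3,a4,a6)"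
proof -
  have "change_coords (1/y) 0 0 0 (a1,a2,a3,a4,a6) = (y*a1,y^2*a2,y^3*a3,y^4*a4,y^6*a6)"
    by (simp add: power_divide mult.commute)
  from change_coords_invariants[of "1/y" 0 0 0 "(a1,a2,a3,a4,a6)", unfolded this] assms
  show "wc4 (y*a1,y^2*a2,y^3*a3,y^4*a4,y^6*a6) = y^4 * wc4 (a1,a2,a3,a4,a6)"
    "wc6 (y*a1,y^2*a2,y^3*a3,y^4*a4,y^6*a6) = y^6 * wc6 (a1,a2,a3,a4,a6)"
    "wdisc (y*a1,y^2*a2,y^3*a3,y^4*a4,y^6*a6) = y^12 * wdisc (a1,a2,a3,a4,a6)"
    by (simp_all add: power_divide field_simps)
qed

context quad_ring begin

lemma weierstrass_invariants_in:
  assumes "a1 \<in> Zw" "a2 \<in> Zw" "a3 \<in> Zw" "a4 \<in> Zw" "a6 \<in> Zw"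
  shows "wc4 (a1,a2,a3,a4,a6) \<in> Zw" "wc6 (a1,a2,a3,a4,a6) \<in> Zw" "wdisc (a1,a2,a3,a4,a6) \<in> Zw"
  unfolding wc4.simps wc6.simps wdisc.simps Let_def using assms by simp_all

end

context quad_integers begin

text \<open>The invariants C4, C6, D are those of a model with unit discriminant at P, up to the change of
  variables u = v / x; the denominator x is multiplied out so that everything lies in the ring.\<close>
definition local_model :: "complex set \<Rightarrow> complex \<Rightarrow> complex \<Rightarrow> complex \<Rightarrow> bool" where
  "local_model P C4 C6 D \<longleftrightarrow> (\<exists>x\<in>Zw - {0}. \<exists>v\<in>Zw - {0}. \<exists>a1\<in>Zw. \<exists>a2\<in>Zw. \<exists>a3\<in>Zw. \<exists>a4\<in>Zw. \<exists>a6\<in>Zw.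
     wdisc (a1,a2,a3,a4,a6) \<notin> P \<and> x^4 * C4 = v^4 * wc4 (a1,a2,a3,a4,a6) \<and>
     x^6 * C6 = v^6 * wc6 (a1,a2,a3,a4,a6) \<and> x^12 * D = v^12 * wdisc (a1,a2,a3,a4,a6))"

text \<open>The denominators of the local coefficients lie outside P. Scaling by their product makes
  the model globally integral while its discriminant stays outside P.\<close>

lemma good_reduction_model:
  assumes P: "P \<in> primes_of K" and good: "good_reduction_at K P E" and nz: "wdisc E \<noteq> 0"
  obtains y u a1 a2 a3 a4 a6 where "y \<in> Zw" "y \<noteq> 0" "u \<in> K" "u \<noteq> 0"
    "a1 \<in> Zw" "a2 \<in> Zw" "a3 \<in> Zw" "a4 \<in> Zw" "a6 \<in> Zw" "wdisc (a1,a2,a3,a4,a6) \<notin> P"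
    "u^4 * wc4 (a1,a2,a3,a4,a6) = y^4 * wc4 E" "u^6 * wc6 (a1,a2,a3,a4,a6) = y^6 * wc6 E"
    "u^12 * wdisc (a1,a2,a3,a4,a6) = y^12 * wdisc E"
proof -
  note Pp = prime_of_props[OF P]
  from good obtain u r s t' where u: "u \<in> K" "u \<noteq> 0"
    and loc: "case change_coords u r s t' E of (b1,b2,b3,b4,b6) \<Rightarrow>
           b1 \<in> localisation K P \<and> b2 \<in> localisation K P \<and> b3 \<in> localisation K P \<and>
           b4 \<in> localisation K P \<and> b6 \<in> localisation K P"
    and inv: "inverse (wdisc (change_coords u r s t' E)) \<in> localisation K P"
    unfolding good_reduction_at_def by (elim bexE conjE) (rule that, assumption+)
  obtain b1 b2 b3 b4 b6 where b: "change_coords u r s t' E = (b1,b2,b3,b4,b6)" by (metis prod_cases5)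
  have locD: "\<exists>x d. x \<in> Zw \<and> d \<in> Zw \<and> d \<notin> P \<and> z = x / d" if "z \<in> localisation K P" for z
    using that unfolding localisation_def integers by blast
  from loc b have "b1 \<in> localisation K P" "b2 \<in> localisation K P" "b3 \<in> localisation K P"
    "b4 \<in> localisation K P" "b6 \<in> localisation K P" by simp_all
  note bl = this[THEN locD]
  obtain x1 d1 where xd1: "x1 \<in> Zw" "d1 \<in> Zw" "d1 \<notin> P" "b1 = x1 / d1" using bl(1) by blast
  obtain x2 d2 where xd2: "x2 \<in> Zw" "d2 \<in> Zw" "d2 \<notin> P" "b2 = x2 / d2" using bl(2) by blast
  obtain x3 d3 where xd3: "x3 \<in> Zw" "d3 \<in> Zw" "d3 \<notin> P" "b3 = x3 / d3" using bl(3) by blast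
  obtain x4 d4 where xd4: "x4 \<in> Zw" "d4 \<in> Zw" "d4 \<notin> P" "b4 = x4 / d4" using bl(4) by blast
  obtain x6 d6 where xd6: "x6 \<in> Zw" "d6 \<in> Zw" "d6 \<notin> P" "b6 = x6 / d6" using bl(5) by blast
  note xd = xd1 xd2 xd3 xd4 xd6
  from inv[unfolded b] obtain x0 d0 where x0: "x0 \<in> Zw" "d0 \<in> Zw" "d0 \<notin> P"
    "inverse (wdisc (b1,b2,b3,b4,b6)) = x0 / d0" using locD by blast
  have dnz: "d1 \<noteq> 0" "d2 \<noteq> 0" "d3 \<noteq> 0" "d4 \<noteq> 0" "d6 \<noteq> 0" "d0 \<noteq> 0" using xd x0 Pp(2) by auto
  define y where "y = d1*d2*d3*d4*d6"
  have yin: "y \<in> Zw" unfolding y_def using xd by simp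
  have multn: "a * b \<notin> P" if "a \<in> Zw" "b \<in> Zw" "a \<notin> P" "b \<notin> P" for a b using Pp(5) that by blast
  have yP: "y \<notin> P" unfolding y_def by (intro multn Zw_mult xd)
  have pown: "y^k \<notin> P" for k
    by (induction k) (use Pp(3) multn yin yP in auto)
  have y0: "y \<noteq> 0" using yP Pp(2) by auto
  define a1 a2 a3 a4 a6 where a: "a1 = y*b1" "a2 = y^2*b2" "a3 = y^3*b3" "a4 = y^4*b4" "a6 = y^6*b6"
  have yb: "y*b1 \<in> Zw" "y*b2 \<in> Zw" "y*b3 \<in> Zw" "y*b4 \<in> Zw" "y*b6 \<in> Zw"
  proof -
    have "y*b1 = x1*d2*d3*d4*d6" "y*b2 = d1*x2*d3*d4*d6" "y*b3 = d1*d2*x3*d4*d6"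
      "y*b4 = d1*d2*d3*x4*d6" "y*b6 = d1*d2*d3*d4*x6"
      unfolding y_def xd using dnz by simp_all
    then show "y*b1 \<in> Zw" "y*b2 \<in> Zw" "y*b3 \<in> Zw" "y*b4 \<in> Zw" "y*b6 \<in> Zw" using xd by simp_all
  qed
  have powin: "y ^ Suc k * b \<in> Zw" if "y * b \<in> Zw" for k b
    using that yin Zw_mult[of "y^k" "y*b"] by (simp add: mult_ac)
  have ain: "a1 \<in> Zw" "a2 \<in> Zw" "a3 \<in> Zw" "a4 \<in> Zw" "a6 \<in> Zw"
    using yb(1) powin[OF yb(2), of 1] powin[OF yb(3), of 2] powin[OF yb(4), of 3] powin[OF yb(5), of 5]
    unfolding a by (simp_all add: eval_nat_numeral)
  note sc = scaling_invariants[OF y0, of b1 b2 b3 b4 b6, folded a]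
  note cc = change_coords_invariants[OF u(2), of r s t' E, unfolded b]
  have db: "wdisc (b1,b2,b3,b4,b6) \<noteq> 0" using cc(3) nz by auto
  \<comment> \<open>The right-hand side is not in P, hence neither is the factor
    \<open>wdisc (a1,a2,a3,a4,a6)\<close>.\<close>
  have "wdisc (a1,a2,a3,a4,a6) * x0 = y^12 * d0"
    using x0(4) db dnz unfolding sc(3) by (simp add: field_simps)
  then have dP: "wdisc (a1,a2,a3,a4,a6) \<notin> P"
    using Pp(4)[of "wdisc (a1,a2,a3,a4,a6)" x0] x0 multn[of "y^12" d0] pown yin by auto
  show ?thesis
  proof (rule that[OF yin y0 u ain dP])
    show "u^4 * wc4 (a1,a2,a3,a4,a6) = y^4 * wc4 E" unfolding sc cc(1)[symmetric] by simp
    show "u^6 * wc6 (a1,a2,a3,a4,a6) = y^6 * wc6 E" unfolding sc cc(2)[symmetric] by simp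
    show "u^12 * wdisc (a1,a2,a3,a4,a6) = y^12 * wdisc E" unfolding sc cc(3)[symmetric] by simp
  qed
qed

text \<open>One global integral model supplies C4, C6 and D, and every local model of good reduction
  is compared with it.\<close>

lemma integral_invariants:
  assumes ell: "elliptic_curve_over K E" and good: "everywhere_good_reduction K E"
  obtains C4 C6 D where "C4 \<in> Zw" "C6 \<in> Zw" "D \<in> Zw" "D \<noteq> 0" "C4^3 - C6^2 = 1728 * D"
    "j_invariant E * D = C4^3" "\<And>P. P \<in> primes_of K \<Longrightarrow> local_model P C4 C6 D"
proof -
  obtain a1 a2 a3 a4 a6 where E: "E = (a1,a2,a3,a4,a6)" by (metis prod_cases5)
  from ell have aK: "a1 \<in> K" "a2 \<in> K" "a3 \<in> K" "a4 \<in> K" "a6 \<in> K" and nz: "wdisc E \<noteq> 0"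
    unfolding E by simp_all
  from K_denom[OF aK(1)] K_denom[OF aK(2)] K_denom[OF aK(3)] K_denom[OF aK(4)] K_denom[OF aK(5)]
  obtain m1 m2 m3 m4 m6 :: int where m: "m1 > 0" "of_int m1 * a1 \<in> Zw" "m2 > 0" "of_int m2 * a2 \<in> Zw"
    "m3 > 0" "of_int m3 * a3 \<in> Zw" "m4 > 0" "of_int m4 * a4 \<in> Zw" "m6 > 0" "of_int m6 * a6 \<in> Zw"
    by blast
  define y :: complex where "y = of_int m1 * of_int m2 * of_int m3 * of_int m4 * of_int m6"
  have y0: "y \<noteq> 0" unfolding y_def using m by auto
  have yin: "y \<in> Zw" unfolding y_def by simp
  have yb: "y*a1 \<in> Zw" "y*a2 \<in> Zw" "y*a3 \<in> Zw" "y*a4 \<in> Zw" "y*a6 \<in> Zw"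
  proof -
    have "y*a1 = (of_int m1 * a1) * (of_int m2 * of_int m3 * of_int m4 * of_int m6)"
      "y*a2 = (of_int m2 * a2) * (of_int m1 * of_int m3 * of_int m4 * of_int m6)"
      "y*a3 = (of_int m3 * a3) * (of_int m1 * of_int m2 * of_int m4 * of_int m6)"
      "y*a4 = (of_int m4 * a4) * (of_int m1 * of_int m2 * of_int m3 * of_int m6)"
      "y*a6 = (of_int m6 * a6) * (of_int m1 * of_int m2 * of_int m3 * of_int m4)"
      unfolding y_def by simp_all
    then show "y*a1 \<in> Zw" "y*a2 \<in> Zw" "y*a3 \<in> Zw" "y*a4 \<in> Zw" "y*a6 \<in> Zw" 
      by (simp_all only: Zw_mult m Zw_of_int)
  qed
  have powin: "y ^ Suc k * b \<in> Zw" if "y * b \<in> Zw" for k b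
    using that yin Zw_mult[of "y^k" "y*b"] by (simp add: mult_ac)
  define c1 c2 c3 c4 c6 where c: "c1 = y*a1" "c2 = y^2*a2" "c3 = y^3*a3" "c4 = y^4*a4" "c6 = y^6*a6"
  have cin: "c1 \<in> Zw" "c2 \<in> Zw" "c3 \<in> Zw" "c4 \<in> Zw" "c6 \<in> Zw"
    using yb(1) powin[OF yb(2), of 1] powin[OF yb(3), of 2] powin[OF yb(4), of 3] powin[OF yb(5), of 5]
    unfolding c by (simp_all add: eval_nat_numeral)
  note sc = scaling_invariants[OF y0, of a1 a2 a3 a4 a6, folded c E]
  show ?thesis
  proof (rule that[OF weierstrass_invariants_in[OF cin]])
    show "wdisc (c1,c2,c3,c4,c6) \<noteq> 0" unfolding sc using y0 nz by simp
    show "wc4 (c1,c2,c3,c4,c6)^3 - wc6 (c1,c2,c3,c4,c6)^2 = 1728 * wdisc (c1,c2,c3,c4,c6)"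
      by (rule wc4_wc6_wdisc)
    show "j_invariant E * wdisc (c1,c2,c3,c4,c6) = wc4 (c1,c2,c3,c4,c6)^3"
      unfolding sc j_invariant_def using nz by (simp add: power_mult_distrib)
    show "local_model P (wc4 (c1,c2,c3,c4,c6)) (wc6 (c1,c2,c3,c4,c6)) (wdisc (c1,c2,c3,c4,c6))"
      if P: "P \<in> primes_of K" for P
    proof -
      from good P have "good_reduction_at K P E" by (simp add: everywhere_good_reduction_def)
      from good_reduction_model[OF P this nz] obtain z u e1 e2 e3 e4 e6 where z: "z \<in> Zw" "z \<noteq> 0" 
        and u: "u \<in> K" "u \<noteq> 0" and e: "e1 \<in> Zw" "e2 \<in> Zw" "e3 \<in> Zw" "e4 \<in> Zw" "e6 \<in> Zw"
        and dP: "wdisc (e1,e2,e3,e4,e6) \<notin> P"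
        and eqs: "u^4 * wc4 (e1,e2,e3,e4,e6) = z^4 * wc4 E" "u^6 * wc6 (e1,e2,e3,e4,e6) = z^6 * wc6 E"
          "u^12 * wdisc (e1,e2,e3,e4,e6) = z^12 * wdisc E" by metis
      from K_denom[OF u(1)] obtain m :: int where m: "m > 0" "of_int m * u \<in> Zw" by blast
      \<comment> \<open>The integer m clears the denominator of u; y is the scaling of the global
        model.\<close>
      define x v where xv: "x = of_int m * z" "v = y * (of_int m * u)"
      have "x \<in> Zw - {0}" "v \<in> Zw - {0}" unfolding xv using m z u y0 yin by auto
      moreover have "x^k * (y^k * C) = v^k * C'" if "u^k * C' = z^k * C" for k C C'
      proof -
        have "x^k * (y^k * C) = of_int m^k * y^k * (z^k * C)" unfolding xv by (simp add: power_mult_distrib mult_ac)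
        also have "\<dots> = v^k * C'" unfolding that[symmetric] xv by (simp add: power_mult_distrib mult_ac)
        finally show ?thesis .
      qed
      ultimately show ?thesis unfolding local_model_def sc using e dP eqs by blast
    qed
  qed
qed

end

subsection \<open>Arithmetic of a rational j-invariant\<close>

context quad_integers begin

lemma local_modelE:
  assumes "local_model P C4 C6 D"
  obtains x v a1 a2 a3 a4 a6 where "x \<in> Zw" "x \<noteq> 0" "v \<in> Zw" "v \<noteq> 0"
    "a1 \<in> Zw" "a2 \<in> Zw" "a3 \<in> Zw" "a4 \<in> Zw" "a6 \<in> Zw" "wdisc (a1,a2,a3,a4,a6) \<notin> P"
    "x^4 * C4 = v^4 * wc4 (a1,a2,a3,a4,a6)" "x^6 * C6 = v^6 * wc6 (a1,a2,a3,a4,a6)"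
    "x^12 * D = v^12 * wdisc (a1,a2,a3,a4,a6)"
proof -
  let ?M = "\<lambda>x v a1 a2 a3 a4 a6. wdisc (a1,a2,a3,a4,a6) \<notin> P \<and> x^4 * C4 = v^4 * wc4 (a1,a2,a3,a4,a6) \<and>
     x^6 * C6 = v^6 * wc6 (a1,a2,a3,a4,a6) \<and> x^12 * D = v^12 * wdisc (a1,a2,a3,a4,a6)"
  from assms obtain x where x: "x \<in> Zw - {0}" "\<exists>v\<in>Zw - {0}. \<exists>a1\<in>Zw. \<exists>a2\<in>Zw. \<exists>a3\<in>Zw. \<exists>a4\<in>Zw. \<exists>a6\<in>Zw.
    ?M x v a1 a2 a3 a4 a6" unfolding local_model_def by (rule bexE)
  from x(2) obtain v where v: "v \<in> Zw - {0}" "\<exists>a1\<in>Zw. \<exists>a2\<in>Zw. \<exists>a3\<in>Zw. \<exists>a4\<in>Zw. \<exists>a6\<in>Zw.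
    ?M x v a1 a2 a3 a4 a6" by (rule bexE)
  from v(2) obtain a1 a2 a3 where a: "a1 \<in> Zw" "a2 \<in> Zw" "a3 \<in> Zw" "\<exists>a4\<in>Zw. \<exists>a6\<in>Zw.
    ?M x v a1 a2 a3 a4 a6" by blast
  from a(4) obtain a4 a6 where b: "a4 \<in> Zw" "a6 \<in> Zw" "?M x v a1 a2 a3 a4 a6" by blast
  have xv: "x \<in> Zw" "x \<noteq> 0" "v \<in> Zw" "v \<noteq> 0" using x(1) v(1) by simp_all
  from b(3) show ?thesis by (elim conjE) (rule that[OF xv a(1-3) b(1,2)])
qed

text \<open>Twelfth powers relate D to a discriminant d of valuation 0. Since C4^3, C6^2 and D all
  have weight 12, a factor j passes unchanged to the local model; it is left general to cover both J
  and J - 1728.\<close>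

lemma place_model:
  assumes pl: "is_place q e P v" and lm: "local_model P C4 C6 D" and D: "D \<in> Zw" "D \<noteq> 0"
  obtains c4 c6 d where "c4 \<in> Zw" "c6 \<in> Zw" "d \<in> Zw" "d \<noteq> 0" "v d = 0" "12 dvd v D"
    "\<forall>j. j * D = C4^3 \<longrightarrow> j * d = c4^3" "\<forall>j. j * D = C6^2 \<longrightarrow> j * d = c6^2"
proof -
  from lm obtain x z a1 a2 a3 a4 a6 where x: "x \<in> Zw" "x \<noteq> 0" and z: "z \<in> Zw" "z \<noteq> 0"
    and a: "a1 \<in> Zw" "a2 \<in> Zw" "a3 \<in> Zw" "a4 \<in> Zw" "a6 \<in> Zw"
    and dP: "wdisc (a1,a2,a3,a4,a6) \<notin> P" 
    and e: "x^4 * C4 = z^4 * wc4 (a1,a2,a3,a4,a6)" "x^6 * C6 = z^6 * wc6 (a1,a2,a3,a4,a6)"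
      "x^12 * D = z^12 * wdisc (a1,a2,a3,a4,a6)"
    by (rule local_modelE)
  note inv = weierstrass_invariants_in[OF a]
  have v0: "v (wdisc (a1,a2,a3,a4,a6)) = 0" using pl inv dP by (simp add: is_place_def)
  have d0: "wdisc (a1,a2,a3,a4,a6) \<noteq> 0" using e(3) x D by auto
  have mult: "v (a * b) = v a + v b" if "a \<in> Zw" "a \<noteq> 0" "b \<in> Zw" "b \<noteq> 0" for a b
    using pl that by (simp add: is_place_def)
  have one: "v 1 = 0" using mult[of 1 1] by simp
  have pow: "v (a ^ k) = k * v a" if "a \<in> Zw" "a \<noteq> 0" for a k
    by (induction k) (use that one mult in auto)
  have "12 * v x + v D = 12 * v z + v (wdisc (a1,a2,a3,a4,a6))"
    using arg_cong[OF e(3), of v] x z D d0 inv by (simp add: mult pow)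
  then have "v D = 12 * v z - 12 * v x" unfolding v0 by simp
  then have 12: "12 dvd v D" by (simp only: dvd_diff_nat dvd_triv_left)
  have j4: "j * wdisc (a1,a2,a3,a4,a6) = wc4 (a1,a2,a3,a4,a6)^3" if "j * D = C4^3" for j
  proof -
    have "z^12 * (j * wdisc (a1,a2,a3,a4,a6)) = j * (x^12 * D)" unfolding e(3) by simp
    also have "\<dots> = (x^4 * C4)^3" using that by (simp add: power_mult_distrib mult.left_commute)
    also have "\<dots> = z^12 * wc4 (a1,a2,a3,a4,a6)^3" unfolding e(1) by (simp add: power_mult_distrib)
    finally show ?thesis using z by simp
  qed
  have j6: "j * wdisc (a1,a2,a3,a4,a6) = wc6 (a1,a2,a3,a4,a6)^2" if "j * D = C6^2" for j
  proof -
    have "z^12 * (j * wdisc (a1,a2,a3,a4,a6)) = j * (x^12 * D)" unfolding e(3) by simp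
    also have "\<dots> = (x^6 * C6)^2" using that by (simp add: power_mult_distrib mult.left_commute)
    also have "\<dots> = z^12 * wc6 (a1,a2,a3,a4,a6)^2" unfolding e(2) by (simp add: power_mult_distrib)
    finally show ?thesis using z by simp
  qed
  show ?thesis by (rule that[OF inv d0 v0 12]) (use j4 j6 in blast)+
qed

lemma place_mult: 
  "is_place q e P v \<Longrightarrow> a \<in> Zw \<Longrightarrow> a \<noteq> 0 \<Longrightarrow> b \<in> Zw \<Longrightarrow> b \<noteq> 0 \<Longrightarrow> v (a * b) = v a + v b"
  by (simp add: is_place_def)

lemma place_power:
  assumes "is_place q e P v" "a \<in> Zw" "a \<noteq> 0" shows "v (a ^ k) = k * v a"
proof (induction k)
  case 0 show ?case using place_mult[OF assms(1), of 1 1] by simp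
next
  case (Suc k) then show ?case using assms by (simp add: place_mult)
qed

lemma place_of_int: "is_place q e P v \<Longrightarrow> k \<noteq> 0 \<Longrightarrow> v (of_int k) = e * multiplicity q k"
  by (simp add: is_place_def)

lemma place_prime: "is_place q e P v \<Longrightarrow> P \<in> primes_of K"
  by (simp add: is_place_def)

text \<open>Over an unramified prime v/e is a valuation with integer values that extends the q-adic
  one. At a ramified prime it may take half-integral values.\<close>

lemma place_exists:
  assumes "prime q"
  obtains e P v where "is_place q e P v" "e = 1 \<or> e = 2"
    "\<not> q dvd t^2 - 4*n \<longrightarrow> (\<forall>c\<in>Zw - {0}. e dvd v c)"
  using assms
proof (cases rule: place_cases)
  case (nonsplit P)
  then show ?thesis using that[of 2 P] by simp
next
  case (split P v P' v')
  then show ?thesis using that[of 1 P v] by simp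
qed

text \<open>With v d = 0, the equation j*d = c4^3 makes e times the valuation of J a multiple of 3,
  and e is prime to 3. For J - 1728 the equation is e times its valuation = 2 * v c6, where e = 2
  cancels the 2; divisibility of v c6 by e restores the conclusion.\<close>

lemma rational_j:
  assumes C: "C4 \<in> Zw" "C6 \<in> Zw" "D \<in> Zw" "D \<noteq> 0" "C4^3 - C6^2 = 1728 * D"
    and j: "j * D = C4^3" "j \<in> \<rat>" and lm: "\<And>P. P \<in> primes_of K \<Longrightarrow> local_model P C4 C6 D"
  obtains J A :: int and R :: nat where "of_int J * D = C4^3" "of_int (J - 1728) * D = C6^2"
    "J = A^3" "\<bar>nrm D\<bar> = int R ^ 4"
    "\<And>q. prime q \<Longrightarrow> \<not> q dvd t^2 - 4*n \<Longrightarrow> J \<noteq> 1728 \<Longrightarrow> even (multiplicity q (J - 1728))"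
proof -
  have "j \<in> \<int>"
  proof -
    from j(2) obtain a b :: int where ab: "b > 0" "coprime a b" "j = of_int a / of_int b"
      by (rule Rats_cases')
    have "is_unit b"
    proof (rule ccontr)
      assume "\<not> is_unit b"
      moreover have "b \<noteq> 0" using ab by simp
      ultimately obtain q where q: "q dvd b" "prime q" using prime_divisor_exists by blast
      have nqa: "\<not> q dvd a" using ab(2) q by (meson coprime_common_divisor not_prime_unit)
      then have a0: "a \<noteq> 0" by auto
      obtain e P v where pl: "is_place q e P v" "e = 1 \<or> e = 2" by (rule place_exists[OF q(2)], rule that)
      obtain c4 c6 d where d: "c4 \<in> Zw" "c6 \<in> Zw" "d \<in> Zw" "d \<noteq> 0" "v d = 0" "12 dvd v D"
      "\<forall>j. j * D = C4^3 \<longrightarrow> j * d = c4^3" "\<forall>j. j * D = C6^2 \<longrightarrow> j * d = c6^2"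
      by (rule place_model[OF pl(1) lm[OF place_prime[OF pl(1)]] C(3,4)], rule that)
      have "j * d = c4^3" using d(7) j(1) by blast
      then have eq: "of_int a * d = of_int b * c4^3" using ab by (simp add: field_simps)
      then have c0: "c4 \<noteq> 0" using a0 d ab by auto
      have "v (of_int a * d) = e * multiplicity q a + v d"
        using pl d a0 by (simp add: place_mult place_of_int)
      also have "\<dots> = 0" using d nqa by (simp add: not_dvd_imp_multiplicity_0)
      finally have "v (of_int b * c4^3) = 0" unfolding eq .
      moreover have "v (of_int b * c4^3) = e * multiplicity q b + v (c4^3)"
        using pl d c0 \<open>b \<noteq> 0\<close> by (simp add: place_mult place_of_int)
      moreover have "multiplicity q b > 0"
        using q prime_multiplicity_gt_zero_iff[OF prime_imp_prime_elem[OF q(2)] \<open>b \<noteq> 0\<close>] by simp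
      ultimately show False using pl(2) by auto
    qed
    then have "b = 1" using ab by simp
    then show ?thesis using ab by simp
  qed
  then obtain J where J: "j = of_int J" by (auto elim: Ints_cases)
  have JD: "of_int J * D = C4^3" using j J by simp
  have JD6: "of_int (J - 1728) * D = C6^2" using JD C(5) by (simp add: algebra_simps)
  have cube: "3 dvd multiplicity q J" if q: "prime q" and "J \<noteq> 0" for q
  proof -
    obtain e P v where pl: "is_place q e P v" "e = 1 \<or> e = 2" by (rule place_exists[OF q], rule that)
    obtain c4 c6 d where d: "c4 \<in> Zw" "c6 \<in> Zw" "d \<in> Zw" "d \<noteq> 0" "v d = 0" "12 dvd v D"
      "\<forall>j. j * D = C4^3 \<longrightarrow> j * d = c4^3" "\<forall>j. j * D = C6^2 \<longrightarrow> j * d = c6^2"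
      by (rule place_model[OF pl(1) lm[OF place_prime[OF pl(1)]] C(3,4)], rule that)
    have Jd: "of_int J * d = c4^3" using d(7) JD by blast
    then have c0: "c4 \<noteq> 0" using \<open>J \<noteq> 0\<close> d by auto
    have "v (of_int J * d) = e * multiplicity q J + v d"
      using place_mult[OF pl(1) Zw_of_int _ d(3,4), of J] place_of_int[OF pl(1) \<open>J \<noteq> 0\<close>] \<open>J \<noteq> 0\<close> by simp
    then have "e * multiplicity q J + v d = 3 * v c4"
      unfolding Jd using place_power[OF pl(1) d(1) c0] by simp
    then have 3: "3 dvd e * multiplicity q J" using d by simp
    from pl(2) show ?thesis
    proof
      assume "e = 1" with 3 show ?thesis by simp
    next
      assume "e = 2" with 3 have "3 dvd 2 * multiplicity q J" by simp
      then show ?thesis by presburger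
    qed
  qed
  have "\<exists>A. J = A^3"
  proof (cases "J = 0")
    case True then show ?thesis by (intro exI[of _ 0]) simp
  next
    case False
    have "\<exists>b::nat. \<bar>J\<bar> = int b ^ 3" by (rule abs_is_nth_power) (use False cube in auto)
    then obtain b :: nat where "\<bar>J\<bar> = int b ^ 3" by blast
    then show ?thesis by (rule odd_power_root[rotated]) simp
  qed
  then obtain A where A: "J = A^3" by blast
  have "4 dvd multiplicity q (nrm D)" if q: "prime q" for q
  proof -
    have v12: "12 dvd v D" if "is_place q e P v" for e P v
      by (rule place_model[OF that lm[OF place_prime[OF that]] C(3,4)])
    have "12 dvd multiplicity q (nrm D)"
      using q
    proof (cases rule: place_cases)
      case (nonsplit P)
      from v12[OF this(1)] show ?thesis .
    next
      case (split P v P' v')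
      have "12 dvd v D + v' D" by (rule dvd_add[OF v12[OF split(1)] v12[OF split(2)]])
      then show ?thesis unfolding split(3)[OF C(3,4)] .
    qed
    then show ?thesis by presburger
  qed
  then have "\<exists>R::nat. \<bar>nrm D\<bar> = int R ^ 4"
    by (intro abs_is_nth_power) (simp_all add: C nrm_eq_0_iff)
  then obtain R :: nat where R: "\<bar>nrm D\<bar> = int R ^ 4" by blast
  have evenJ: "even (multiplicity q (J - 1728))" 
    if q: "prime q" and ur: "\<not> q dvd t^2 - 4*n" and J0: "J \<noteq> 1728" for q
  proof -
    obtain e P v where pl: "is_place q e P v" "e = 1 \<or> e = 2" 
      and ev: "\<not> q dvd t^2 - 4*n \<longrightarrow> (\<forall>c\<in>Zw - {0}. e dvd v c)"
      by (rule place_exists[OF q], rule that)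
    obtain c4 c6 d where d: "c4 \<in> Zw" "c6 \<in> Zw" "d \<in> Zw" "d \<noteq> 0" "v d = 0" "12 dvd v D"
      "\<forall>j. j * D = C4^3 \<longrightarrow> j * d = c4^3" "\<forall>j. j * D = C6^2 \<longrightarrow> j * d = c6^2"
      by (rule place_model[OF pl(1) lm[OF place_prime[OF pl(1)]] C(3,4)], rule that)
    have J1: "J - 1728 \<noteq> 0" using J0 by simp
    have Jd: "of_int (J - 1728) * d = c6^2" using d(8) JD6 by blast
    have "of_int (J - 1728) * d \<noteq> 0" using d(4) J1 by (simp only: mult_eq_0_iff of_int_eq_0_iff) simp
    then have c0: "c6 \<noteq> 0" unfolding Jd by simp
    have "v (of_int (J - 1728) * d) = e * multiplicity q (J - 1728) + v d"
      using place_mult[OF pl(1) Zw_of_int _ d(3,4), of "J - 1728"] place_of_int[OF pl(1) J1] J1 by simp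
    then have "e * multiplicity q (J - 1728) = 2 * v c6"
      unfolding Jd using place_power[OF pl(1) d(2) c0] d by simp
    moreover have "e dvd v c6" using ev ur d(2) c0 by blast
    ultimately show ?thesis using pl(2) by auto
  qed
  show ?thesis by (rule that[OF JD JD6 A R evenJ])
qed

lemma abs_square_or_prime_times_square:
  fixes M p :: int
  assumes M: "M \<noteq> 0" and p: "prime p" and ev: "\<And>q. prime q \<Longrightarrow> q \<noteq> p \<Longrightarrow> even (multiplicity q M)"
  shows "(\<exists>T. \<bar>M\<bar> = T^2) \<or> (\<exists>T. p * \<bar>M\<bar> = T^2)"
proof (cases "even (multiplicity p M)")
  case True
  then have "even (multiplicity q M)" if "prime q" for q using ev that by blast
  then have "\<exists>b::nat. \<bar>M\<bar> = int b ^ 2" by (intro abs_is_nth_power) (use M in auto)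
  then show ?thesis by blast
next
  case False
  have p0: "p \<noteq> 0" using p by auto
  have "even (multiplicity q (p * M))" if q: "prime q" for q
  proof -
    have "multiplicity q (p * M) = multiplicity q p + multiplicity q M"
      using multiplicity_mult_prime[OF q p0 M] .
    moreover have "multiplicity p p = 1" using p by (intro multiplicity_self) auto
    then have "multiplicity q p = (if q = p then 1 else 0)"
      using p q by (simp add: prime_multiplicity_other)
    ultimately show ?thesis using False ev[OF q] by auto
  qed
  then have "\<exists>b::nat. \<bar>p * M\<bar> = int b ^ 2" by (intro abs_is_nth_power) (use M p0 in auto)
  then obtain T :: nat where "\<bar>p * M\<bar> = int T ^ 2" by blast
  moreover have "p > 0" using p by (simp add: prime_gt_0_int)
  ultimately have "p * \<bar>M\<bar> = int T ^ 2" by (simp add: abs_mult)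
  then show ?thesis by blast
qed

text \<open>Everything specific to one field is in the hypotheses; \<open>red\<close> lists the
  reduction types at the prime above 2. The numbers 64 and 16 are squares, so h carries the class of
  the norm modulo squares.\<close>

lemma no_rational_j_everywhere_good:
  fixes p :: int
  assumes p: "prime p" "odd p"
    and disc: "\<And>q. prime q \<Longrightarrow> q dvd t^2 - 4*n \<Longrightarrow> q = 2 \<or> q = p"
    and two: "{z \<in> Zw. even (nrm z)} \<in> primes_of K"
    and red: "\<And>a1 a2 a3 a4 a6. a1 \<in> Zw \<Longrightarrow> a2 \<in> Zw \<Longrightarrow> a3 \<in> Zw \<Longrightarrow> a4 \<in> Zw \<Longrightarrow> a6 \<in> Zw \<Longrightarrow>
      odd (nrm (wdisc (a1,a2,a3,a4,a6))) \<Longrightarrow>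
      (\<exists>h. odd (nrm (wc4 (a1,a2,a3,a4,a6))) \<and> nrm (wc6 (a1,a2,a3,a4,a6)) = h \<and> odd h \<and> p * \<bar>h\<bar> mod 8 \<noteq> 1) \<or>
      (\<exists>h k. nrm (wc4 (a1,a2,a3,a4,a6)) = 256 * k \<and> nrm (wc6 (a1,a2,a3,a4,a6)) = 64 * h \<and> odd h \<and> p * \<bar>h\<bar> mod 8 \<noteq> 1) \<or>
      (\<exists>h. nrm (wc4 (a1,a2,a3,a4,a6)) = 16 * h \<and> odd h \<and> \<bar>h\<bar> mod 8 \<noteq> 1)"
    and E: "elliptic_curve_over K E" "everywhere_good_reduction K E" "j_invariant E \<in> \<rat>"
  shows False
proof -
  from integral_invariants[OF E(1,2)] obtain C4 C6 D where C: "C4 \<in> Zw" "C6 \<in> Zw" "D \<in> Zw" "D \<noteq> 0"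
    "C4^3 - C6^2 = 1728 * D" and jD: "j_invariant E * D = C4^3" 
    and lm: "\<And>P. P \<in> primes_of K \<Longrightarrow> local_model P C4 C6 D" by metis
  from rational_j[OF C jD E(3) lm] obtain J A :: int and R :: nat where JD: "of_int J * D = C4^3"
    and JD6: "of_int (J - 1728) * D = C6^2" and A: "J = A^3" and R: "\<bar>nrm D\<bar> = int R ^ 4"
    and ev: "\<And>q. prime q \<Longrightarrow> \<not> q dvd t^2 - 4*n \<Longrightarrow> J \<noteq> 1728 \<Longrightarrow> even (multiplicity q (J - 1728))" by metis
  have R0: "R \<noteq> 0" using R nrm_eq_0_iff[OF C(3)] C(4) by (intro notI) simp
  have n4: "J^2 * nrm D = nrm C4 ^ 3"
    using arg_cong[OF JD, of nrm] C nrm_mult[of "of_int J" D] by (simp add: nrm_power)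
  have n6: "(J - 1728)^2 * nrm D = nrm C6 ^ 2"
    using arg_cong[OF JD6, of nrm] C nrm_mult[OF Zw_of_int[of "J - 1728"] C(3)] nrm_power[OF C(2), of 2] 
    by (simp only: nrm_of_int)
  have absC6: "\<bar>nrm C6\<bar> = \<bar>J - 1728\<bar> * int R ^ 2"
  proof -
    have "\<bar>nrm C6\<bar>^2 = \<bar>(J - 1728)^2 * nrm D\<bar>" unfolding n6 by simp
    also have "\<dots> = (\<bar>J - 1728\<bar> * int R ^ 2)^2" unfolding abs_mult R by (simp add: power_mult_distrib)
    finally show ?thesis by (metis abs_ge_zero power2_eq_iff_nonneg zero_le_mult_iff zero_le_power2)
  qed
  from lm[OF two] obtain x v a1 a2 a3 a4 a6 where x: "x \<in> Zw" "x \<noteq> 0" and v: "v \<in> Zw" "v \<noteq> 0"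
    and a: "a1 \<in> Zw" "a2 \<in> Zw" "a3 \<in> Zw" "a4 \<in> Zw" "a6 \<in> Zw"
    and dP: "wdisc (a1,a2,a3,a4,a6) \<notin> {z \<in> Zw. even (nrm z)}" 
    and e: "x^4 * C4 = v^4 * wc4 (a1,a2,a3,a4,a6)" "x^6 * C6 = v^6 * wc6 (a1,a2,a3,a4,a6)"
      "x^12 * D = v^12 * wdisc (a1,a2,a3,a4,a6)"
    by (rule local_modelE)
  note inv = weierstrass_invariants_in[OF a]
  define c4 c6 d where cd: "c4 = nrm (wc4 (a1,a2,a3,a4,a6))" "c6 = nrm (wc6 (a1,a2,a3,a4,a6))"
    "d = nrm (wdisc (a1,a2,a3,a4,a6))"
  define X V where XV: "X = nrm x" "V = nrm v"
  have X0: "X \<noteq> 0" "V \<noteq> 0" unfolding XV using x v by (simp_all add: nrm_eq_0_iff)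
  have e': "X^4 * nrm C4 = V^4 * c4" "X^6 * nrm C6 = V^6 * c6" "X^12 * nrm D = V^12 * d"
    using e[THEN arg_cong[of _ _ nrm]] x v C inv unfolding XV cd by (simp_all add: nrm_mult nrm_power)
  have dodd: "odd d" unfolding cd using dP inv by simp
  have jd: "J^2 * d = c4^3"
  proof -
    have "V^12 * (J^2 * d) = J^2 * (X^12 * nrm D)" unfolding e'(3) by simp
    also have "\<dots> = X^12 * (J^2 * nrm D)" by simp
    also have "\<dots> = (X^4 * nrm C4)^3" unfolding n4 by (simp add: power_mult_distrib)
    also have "\<dots> = V^12 * c4^3" unfolding e'(1) by (simp add: power_mult_distrib)
    finally show ?thesis using X0 by simp
  qed
  have square: "\<exists>T. \<bar>J - 1728\<bar> = T^2" 
    if c6: "c6 = s^2 * h" and h: "odd h" "p * \<bar>h\<bar> mod 8 \<noteq> 1" and J2: "even (multiplicity 2 (J - 1728))" and s: "s \<noteq> 0" for s h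
  proof (cases "J = 1728")
    case True then show ?thesis by (intro exI[of _ 0]) simp
  next
    case False
    then have M: "J - 1728 \<noteq> 0" by simp
    have "even (multiplicity q (J - 1728))" if "prime q" "q \<noteq> p" for q
      using disc[OF that(1)] ev[OF that(1) _ False] J2 that(2) by blast
    from abs_square_or_prime_times_square[OF M p(1) this] show ?thesis
    proof
      assume "\<exists>T. p * \<bar>J - 1728\<bar> = T^2"
      then obtain T where T: "p * \<bar>J - 1728\<bar> = T^2" by blast
      \<comment> \<open>Only squares separate |J - 1728| from |h|, so p * |h| would be a ratio of
        squares.\<close>
      have "\<bar>J - 1728\<bar> * (R * X^3)^2 = \<bar>X^6 * nrm C6\<bar>"
        unfolding abs_mult absC6 by (simp add: power_mult_distrib power_abs)
      also have "\<dots> = \<bar>h\<bar> * (V^3 * s)^2" unfolding e'(2) c6 abs_mult 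
        by (simp add: power_mult_distrib power_abs)
      finally have eq: "\<bar>J - 1728\<bar> * (R * X^3)^2 = \<bar>h\<bar> * (V^3 * s)^2" .
      have "(p * \<bar>h\<bar>) * (V^3 * s)^2 = p * \<bar>J - 1728\<bar> * (R * X^3)^2" using eq by simp
      also have "\<dots> = (T * (R * X^3))^2" unfolding T by (simp add: power_mult_distrib)
      finally have "p * \<bar>h\<bar> mod 8 = 1"
        by (rule square_ratio_mod_8[rotated 2]) (use h p X0 s in auto)
      with h(2) show ?thesis by blast
    qed
  qed
  consider (ordinary) "odd c4" "odd c6" "p * \<bar>c6\<bar> mod 8 \<noteq> 1"
    | (supersingular) h k where "c4 = 256 * k" "c6 = 64 * h" "odd h" "p * \<bar>h\<bar> mod 8 \<noteq> 1"
    | (mixed) h where "c4 = 16 * h" "odd h" "\<bar>h\<bar> mod 8 \<noteq> 1"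
    using red[OF a] dodd unfolding cd by blast
  then show False
  proof cases
    case ordinary
    have "odd (J^2 * d)" unfolding jd using ordinary by simp
    then have oddJ: "odd J" by auto
    then have "odd (J - 1728)" by simp
    then have "even (multiplicity 2 (J - 1728))" by (simp add: not_dvd_imp_multiplicity_0)
    from square[of 1 c6, OF _ ordinary(2,3) this] obtain T where "\<bar>J - 1728\<bar> = T^2" by auto
    moreover have "odd A" using oddJ A by simp
    ultimately show False using abs_cube_minus_1728_not_square unfolding A by blast
  next
    case supersingular
    \<comment> \<open>The cube of 256 is 2^24.\<close>
    have "(2^12)^2 dvd J^2 * d" unfolding jd supersingular by (simp add: power_mult_distrib)
    moreover have "coprime 2 d" using dodd by simp
    then have "coprime ((2^12)^2) d" unfolding coprime_power_left_iff by blast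
    ultimately have "(2^12)^2 dvd J^2" by (simp add: coprime_dvd_mult_left_iff)
    then have "2^12 dvd J" by (metis pow_divides_pow_iff zero_less_numeral)
    then obtain i where i: "J = 2^12 * i" by (rule dvdE)
    \<comment> \<open>As 1728 = 2^6 * 27, exactly the sixth power of 2 divides J - 1728. This
      supplies the parity at 2, where \<open>rational_j\<close> is silent if 2 ramifies.\<close>
    define u where "u = 64*i - 27"
    have Ju: "J - 1728 = 2^6 * u" unfolding i u_def by simp
    have oddu: "odd u" unfolding u_def by simp
    have "multiplicity 2 (J - 1728) = multiplicity 2 ((2::int)^6) + multiplicity 2 u"
      unfolding Ju by (rule multiplicity_mult_prime) (use oddu in auto)
    also have "multiplicity 2 ((2::int)^6) = 6" by (rule multiplicity_same_power) auto
    also have "6 + multiplicity 2 u = 6" using oddu by (simp add: not_dvd_imp_multiplicity_0)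
    finally have "even (multiplicity 2 (J - 1728))" by simp
    from square[of 8 h, OF _ supersingular(3,4) this] supersingular obtain T where T: "\<bar>J - 1728\<bar> = T^2" by auto
    have "\<bar>u\<bar> * 8^2 = T^2" using T unfolding Ju abs_mult by simp
    then have "\<bar>u\<bar> mod 8 = 1" by (rule square_ratio_mod_8[rotated 2]) (use oddu in auto)
    moreover have "u mod 8 = 5" unfolding u_def by presburger
    ultimately show False by presburger
  next
    case mixed
    have C0: "nrm C4 \<noteq> 0"
    proof
      assume "nrm C4 = 0"
      with e'(1) X0 mixed show False by simp
    qed
    \<comment> \<open>The factor (nrm C4)^2 turns nrm C4 into its cube, which equals J^2 * nrm D and
      is a square up to sign.\<close>
    have "\<bar>h\<bar> * (4 * V^2 * nrm C4)^2 = \<bar>V^4 * c4\<bar> * (nrm C4)^2"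
      unfolding mixed abs_mult by (simp add: power_mult_distrib power_abs)
    also have "\<dots> = X^4 * \<bar>nrm C4 ^ 3\<bar>"
      unfolding e'(1)[symmetric] abs_mult by (simp add: power2_eq_square power3_eq_cube abs_mult)
    also have "\<dots> = (X^2 * J * int R ^ 2)^2"
      unfolding n4[symmetric] abs_mult R by (simp add: power_mult_distrib)
    finally have "\<bar>h\<bar> mod 8 = 1"
      by (rule square_ratio_mod_8[rotated 2]) (use mixed X0 C0 in auto)
    with mixed show False by blast
  qed
qed

end

subsection \<open>The ring of integers of a quadratic field\<close>

lemma map_poly_of_int_add:
  "map_poly of_int (p + q) = (map_poly of_int p + map_poly of_int q :: 'a::comm_ring_1 poly)"
  by (intro poly_eqI) (simp add: coeff_map_poly)

lemma map_poly_of_int_mult: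
  "map_poly of_int (p * q) = (map_poly of_int p * map_poly of_int q :: 'a::comm_ring_1 poly)"
  by (intro poly_eqI) (simp add: coeff_map_poly coeff_mult)

text \<open>Gauss's lemma: the primitive integer multiple g of the quadratic divides the monic f up
  to a constant, and comparing contents makes the leading coefficient of g a unit.\<close>

lemma integral_quadratic:
  fixes z :: complex and T N :: rat
  assumes z: "algebraic_int z" and quad: "z^2 = of_rat T * z - of_rat N"
    and indep: "\<And>x y :: int. of_int x + of_int y * z = 0 \<Longrightarrow> x = 0 \<and> y = 0"
  shows "T \<in> \<int>" "N \<in> \<int>"
proof -
  obtain T1 T2 where T: "quotient_of T = (T1, T2)" by fastforce
  obtain N1 N2 where N: "quotient_of N = (N1, N2)" by fastforce
  define m where "m = T2 * N2"
  have pos: "T2 > 0" "N2 > 0" using T N quotient_of_denom_pos by blast+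
  then have m0: "m \<noteq> 0" unfolding m_def by simp
  have TN: "T = of_int T1 / of_int T2" "N = of_int N1 / of_int N2"
    using T N quotient_of_div by blast+
  define b c where bc: "b = T1 * N2" "c = T2 * N1"
  have mT: "of_int m * T = of_int b" and mN: "of_int m * N = of_int c"
    unfolding m_def bc TN using pos by simp_all
  define g1 where "g1 = [:c, -b, m:]"
  define g where "g = primitive_part g1"
  have g1: "g1 \<noteq> 0" unfolding g1_def using m0 by simp
  have g1g: "g1 = smult (content g1) g" unfolding g_def by simp
  have "poly (map_poly of_int g1) z = of_int m * z^2 - of_int b * z + of_int c"
    unfolding g1_def by (simp add: map_poly_pCons power2_eq_square algebra_simps)
  also have "of_int m * z^2 = of_rat (of_int m * T) * z - of_rat (of_int m * N)"
    unfolding quad by (simp add: of_rat_mult algebra_simps)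
  finally have "poly (map_poly of_int g1) z = 0" unfolding mT mN by simp
  then have "of_int (content g1) * poly (map_poly of_int g) z = (0::complex)"
    by (subst (asm) g1g) (simp add: map_poly_smult)
  then have gz: "poly (map_poly of_int g) z = 0" using g1 by simp
  have g0: "g \<noteq> 0" and cg: "content g = 1" unfolding g_def using g1 by simp_all
  have dg: "degree g = 2" unfolding g_def using m0 by (simp add: g1_def)
  from z obtain f :: "int poly" where f: "poly (map_poly of_int f) z = 0" "lead_coeff f = 1"
    unfolding algebraic_int_altdef_ipoly by blast
  obtain q r where qr: "pseudo_divmod f g = (q, r)" by fastforce
  define l where "l = coeff g (degree g) ^ (Suc (degree f) - degree g)"
  have l0: "l \<noteq> 0" unfolding l_def using g0 by simp
  have eq: "smult l f = g * q + r" unfolding l_def by (rule pseudo_divmod(1)[OF g0 qr])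
  have rdeg: "r = 0 \<or> degree r < 2" using pseudo_divmod(2)[OF g0 qr] dg by simp
  have "poly (map_poly of_int (smult l f)) z = (0::complex)" using f by (simp add: map_poly_smult)
  then have "poly (map_poly of_int r) z = (0::complex)"
    unfolding eq using gz by (simp add: map_poly_of_int_add map_poly_of_int_mult)
  moreover obtain r0 r1 where r: "r = [:r0, r1:]"
  proof
    show "r = [:coeff r 0, coeff r 1:]"
      using rdeg by (intro poly_eqI) (auto simp: coeff_pCons coeff_eq_0 split: nat.split)
  qed
  ultimately have "of_int r0 + of_int r1 * z = 0" by (simp add: map_poly_pCons mult.commute)
  \<comment> \<open>Independence of 1 and z replaces irreducibility of the quadratic.\<close>
  from indep[OF this] have "r = 0" unfolding r by simp
  then have eq: "smult l f = g * q" using eq by simp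
  have "content f = 1"
  proof -
    have "content f dvd lead_coeff f" by (rule content_dvd_coeff)
    then show ?thesis using f(2) by (metis normalize_content is_unit_normalize)
  qed
  then have "content q = \<bar>l\<bar>" using arg_cong[OF eq, of content] cg by (simp add: content_mult)
  then have "q = smult \<bar>l\<bar> (primitive_part q)" by (metis content_times_primitive_part)
  then have "smult \<bar>l\<bar> (g * primitive_part q) = smult l f" using eq by (metis mult_smult_right)
  then have "\<bar>l\<bar> * lead_coeff (g * primitive_part q) = l * lead_coeff f" by (metis lead_coeff_smult)
  then have "\<bar>l\<bar> * (lead_coeff g * lead_coeff (primitive_part q)) = l"
    using f(2) by (simp add: lead_coeff_mult)
  then have "\<bar>l\<bar> * \<bar>lead_coeff g * lead_coeff (primitive_part q)\<bar> = \<bar>l\<bar>"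
    by (metis abs_idempotent abs_mult)
  then have "is_unit (lead_coeff g * lead_coeff (primitive_part q))" using l0 by simp
  then have "is_unit (lead_coeff g)" by (simp only: is_unit_mult_iff)
  moreover have "m = content g1 * lead_coeff g"
    using arg_cong[OF g1g, of "\<lambda>p. coeff p 2"] dg by (simp add: g1_def numeral_2_eq_2)
  ultimately have "m dvd content g1" by (metis mult_unit_dvd_iff dvd_refl)
  moreover have "content g1 dvd coeff g1 i" for i by (rule content_dvd_coeff)
  ultimately have "m dvd coeff g1 0" "m dvd coeff g1 1" using dvd_trans by blast+
  then have "m dvd c" "m dvd b" by (simp_all add: g1_def)
  then obtain c' b' where "c = m * c'" "b = m * b'" by (metis dvdE)
  then have "of_int m * N = of_int m * of_int c'" "of_int m * T = of_int m * of_int b'"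
    using mN mT by simp_all
  then have "N = of_int c'" "T = of_int b'" using m0 by simp_all
  then show "T \<in> \<int>" "N \<in> \<int>" by simp_all
qed

lemma (in quad_ring) Zw_algebraic_int:
  assumes "z \<in> Zw" shows "algebraic_int z"
proof -
  from assms obtain x y where z: "z = el x y" by (rule el_cases)
  have "z^2 - of_int (2*x + t*y) * z + of_int (nrm z) = of_int y^2 * (w^2 - of_int t * w + of_int n)"
    unfolding z nrm_el by (simp add: el_def power2_eq_square algebra_simps)
  then have "poly (map_poly of_int [:nrm z, -(2*x+t*y), 1:]) z = 0"
    unfolding root by (simp add: map_poly_pCons power2_eq_square algebra_simps)
  moreover have "lead_coeff [:nrm z, -(2*x+t*y), 1:] = 1" by simp
  ultimately show ?thesis unfolding algebraic_int_altdef_ipoly by blast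
qed

lemma rat_square_times_prime_int:
  fixes r :: rat and p :: int
  assumes "prime p" "of_int p * r^2 \<in> \<int>"
  shows "r \<in> \<int>"
proof -
  obtain a b where q: "quotient_of r = (a, b)" by fastforce
  have b: "b > 0" "coprime a b" "r = of_int a / of_int b"
    using q quotient_of_denom_pos quotient_of_coprime quotient_of_div by blast+
  from assms(2) obtain k where k: "of_int p * r^2 = of_int k" by (auto elim: Ints_cases)
  then have "of_int (p * a^2) = (of_int (k * b^2) :: rat)"
    unfolding b(3) using b(1) by (simp add: field_simps)
  then have eq: "p * a^2 = k * b^2" by (simp only: of_int_eq_iff)
  have "coprime (b^2) (a^2)" using b(2) by (simp add: coprime_commute)
  moreover have "b^2 dvd p * a^2" unfolding eq by simp
  ultimately have "b^2 dvd p" by (simp only: coprime_dvd_mult_left_iff)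
  then have "b dvd 1" using squarefreeD[OF squarefree_prime[OF assms(1)]] by blast
  then have "b = 1" using b(1) by simp
  then show ?thesis using b(3) by simp
qed

section \<open>Integers of Q(sqrt p) and Q(sqrt(-p)) in half-integral coordinates\<close>

locale quad_case =
  fixes p :: nat and d :: int and s :: complex
  assumes p: "prime p" and p8: "p mod 8 = 3" and d: "d = int p \<or> d = - int p"
  defines "s \<equiv> csqrt (of_int d)"
begin

lemma s_square: "s^2 = of_int d"
  unfolding s_def by simp

lemma d_not_square: "of_rat a ^ 2 \<noteq> (of_int d :: complex)"
proof
  assume "of_rat a ^ 2 = (of_int d :: complex)"
  then have "of_rat (a^2) = (of_rat (of_int d) :: complex)" by (simp add: of_rat_power)
  then have a: "a^2 = of_int d" by (simp only: of_rat_eq_iff)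
  have "d \<ge> 0"
  proof -
    have "(0::rat) \<le> of_int d" unfolding a[symmetric] by simp
    then show ?thesis by simp
  qed
  then have dp: "d = int p" using d by auto
  have pr: "prime (int p)" using p by simp
  \<comment> \<open>From a^2 = p the number a/p would be an integer k with p * k^2 = 1.\<close>
  have "of_int (int p) * (a / of_int (int p))^2 = (1 :: rat)" 
    using p unfolding power_divide a dp by (simp add: power2_eq_square prime_gt_0_nat)
  then have "a / of_int (int p) \<in> \<int>" using rat_square_times_prime_int[OF pr] by (metis Ints_1)
  then obtain k where "a / of_int (int p) = of_int k" by (rule Ints_cases)
  then have "of_int (int p * k^2) = (1 :: rat)" 
    using \<open>of_int (int p) * (a / of_int (int p))^2 = 1\<close> by simp
  then have "int p * k^2 = 1" by (simp only: of_int_eq_1_iff)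
  then have "int p dvd 1" by (metis dvd_triv_left)
  then show False using pr not_prime_unit by blast
qed

lemma rat_indep:
  assumes "of_rat a + of_rat b * s = 0" shows "a = 0 \<and> b = 0"
proof (cases "b = 0")
  case True with assms show ?thesis by simp
next
  case False
  then have "s = of_rat (- a / b)" using assms
    by (simp add: of_rat_divide of_rat_minus field_simps add_eq_0_iff)
  then have "of_rat (- a / b) ^ 2 = (of_int d :: complex)" using s_square by simp
  with d_not_square show ?thesis by blast
qed

text \<open>The trace 2*a and the norm are integers, hence so is d*(2*b)^2; as p is squarefree, 2*b
  is an integer. For b = 0 the quadratic is not the minimal polynomial.\<close>

lemma algebraic_int_coordinates:
  assumes "algebraic_int (of_rat a + of_rat b * s)"
  obtains x y :: int where "2 * a = of_int x" "2 * b = of_int y" "4 dvd x^2 - d * y^2"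
proof (cases "b = 0")
  case True
  then have "algebraic_int (of_rat a :: complex)" using assms by simp
  then have "(of_rat a :: complex) \<in> \<int>" by (rule rational_algebraic_int_is_int) simp
  then obtain k where "of_rat a = (of_int k :: complex)" by (rule Ints_cases)
  then have "of_rat a = (of_rat (of_int k) :: complex)" by simp
  then have "a = of_int k" by (simp only: of_rat_eq_iff)
  then show ?thesis using that[of "2*k" 0] True by simp
next
  case False
  define z where "z = of_rat a + of_rat b * s"
  have q: "z^2 = of_rat (2*a) * z - of_rat (a^2 - of_int d * b^2)"
  proof -
    have "z^2 = of_rat a^2 + 2 * of_rat a * of_rat b * s + of_rat b^2 * s^2"
      unfolding z_def by (simp add: power2_eq_square algebra_simps)
    then show ?thesis unfolding s_square z_def
      by (simp add: power2_eq_square of_rat_mult of_rat_diff of_rat_add algebra_simps)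
  qed
  have "x = 0 \<and> y = 0" if "of_int x + of_int y * z = 0" for x y :: int
  proof -
    have "of_rat (of_int x + of_int y * a) + of_rat (of_int y * b) * s = 0"
      using that unfolding z_def by (simp add: of_rat_add of_rat_mult algebra_simps)
    from rat_indep[OF this] False show ?thesis by auto
  qed
  note int = integral_quadratic[OF assms[folded z_def] q this]
  obtain x where x: "2*a = of_int x" using int(1) by (rule Ints_cases)
  obtain N where N: "a^2 - of_int d * b^2 = of_int N" using int(2) by (rule Ints_cases)
  have "of_int d * (2*b)^2 = (2*a)^2 - 4 * (a^2 - of_int d * b^2)"
    by (simp add: power2_eq_square algebra_simps)
  also have "\<dots> = of_int (x^2 - 4*N)" unfolding x N by simp
  finally have dd: "of_int d * (2*b)^2 = of_int (x^2 - 4*N)" .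
  have dint: "of_int d * (2*b)^2 \<in> \<int>" unfolding dd by (rule Ints_of_int)
  have "of_int (int p) * (2*b)^2 \<in> \<int>"
    using d
  proof
    assume "d = int p" with dint show ?thesis by (simp only:)
  next
    assume "d = - int p"
    then have "of_int (int p) * (2*b)^2 = - (of_int d * (2*b)^2)" by simp
    with dint show ?thesis by (simp only: Ints_minus)
  qed
  then have "2*b \<in> \<int>" by (rule rat_square_times_prime_int[rotated]) (use p in simp)
  then obtain y where y: "2*b = of_int y" by (rule Ints_cases)
  have "of_int (d * y^2) = of_int d * (2*b)^2" unfolding y by simp
  then have "of_int (d * y^2) = (of_int (x^2 - 4*N) :: rat)" unfolding dd .
  then have "d * y^2 = x^2 - 4*N" by (simp only: of_int_eq_iff)
  then have "x^2 - d * y^2 = 4 * N" by simp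
  then have "4 dvd x^2 - d * y^2" by (rule dvdI)
  with x y show ?thesis by (rule that)
qed

text \<open>Integers of the field are the (x + y*s)/2 with 4 dividing x^2 - d*y^2, so it remains to
  express these in the chosen basis.\<close>

lemma integers_eqI:
  assumes qr: "quad_ring w t n" 
    and w: "w \<in> quad_field d"
    and half: "\<And>x y. 4 dvd x^2 - d * y^2 \<Longrightarrow> \<exists>u v. (of_int x + of_int y * s) / 2 = of_int u + of_int v * w"
  shows "quad_integers w t n (quad_field d)"
proof -
  interpret quad_ring w t n by fact
  have fld: "quad_field d = {of_rat a + of_rat b * s | a b. True}" unfolding quad_field_def s_def ..
  show ?thesis
  proof
    show "ring_of_integers (quad_field d) = Zw"
    proof (intro equalityI subsetI)
      fix z assume "z \<in> ring_of_integers (quad_field d)"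
      then obtain a b where z: "z = of_rat a + of_rat b * s" "algebraic_int z"
        unfolding ring_of_integers_def fld by blast
      from algebraic_int_coordinates[OF z(2)[unfolded z(1)]] obtain x y :: int
        where xy: "2*a = of_int x" "2*b = of_int y" "4 dvd x^2 - d*y^2" by blast
      have "2 * z = of_rat (2*a) + of_rat (2*b) * s" unfolding z(1) by (simp add: of_rat_mult algebra_simps)
      then have "z = (of_int x + of_int y * s) / 2" unfolding xy by (simp add: eq_divide_eq mult.commute)
      moreover obtain u v where "(of_int x + of_int y * s) / 2 = of_int u + of_int v * w"
        using half[OF xy(3)] by (elim exE)
      ultimately have "z = el u v" by (simp only: el_def)
      then show "z \<in> Zw" by simp
    next
      fix z assume z: "z \<in> Zw"
      then obtain x y where xy: "z = el x y" by (rule el_cases)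
      from w obtain a b where w': "w = of_rat a + of_rat b * s" unfolding fld by blast
      have "z = of_int x + of_int y * w" unfolding xy el_def ..
      then have "z = of_rat (of_int x + of_int y * a) + of_rat (of_int y * b) * s"
        unfolding w' by (simp add: of_rat_add of_rat_mult algebra_simps)
      then have "z \<in> quad_field d" unfolding fld by blast
      then show "z \<in> ring_of_integers (quad_field d)"
        using Zw_algebraic_int[OF z] by (simp add: ring_of_integers_def)
    qed
    show "\<exists>m>0. of_int m * z \<in> Zw" if "z \<in> quad_field d" for z
    proof -
      from that obtain a b where z: "z = of_rat a + of_rat b * s" unfolding fld by blast
      obtain a1 a2 where a: "quotient_of a = (a1, a2)" by fastforce
      obtain b1 b2 where b: "quotient_of b = (b1, b2)" by fastforce
      have pos: "a2 > 0" "b2 > 0" using a b quotient_of_denom_pos by blast+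
      have ab: "a = of_int a1 / of_int a2" "b = of_int b1 / of_int b2"
        using a b quotient_of_div by blast+
      \<comment> \<open>Doubled coordinates satisfy the divisibility by 4 trivially.\<close>
      obtain u v where uv: "(of_int (2 * (a1*b2)) + of_int (2 * (b1*a2)) * s) / 2 = of_int u + of_int v * w"
        using half[of "2*(a1*b2)" "2*(b1*a2)"] by (auto simp: power_mult_distrib)
      have "of_int (a2 * b2) * z = (of_int (2 * (a1*b2)) + of_int (2 * (b1*a2)) * s) / 2"
        unfolding z ab using pos by (simp add: of_rat_divide field_simps)
      then have "of_int (a2 * b2) * z \<in> Zw" unfolding uv Zw_def el_def by blast
      then show ?thesis using pos by (intro exI[of _ "a2*b2"]) simp
    qed
  qed
qed

end

section \<open>Integral bases and the contradiction in each field\<close>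

context quad_case begin

lemma p_odd_prime: "prime (int p)" "odd (int p)" "int p mod 8 = 3"
proof -
  show "prime (int p)" using p by simp
  have "int (p mod 8) = 3" using p8 by simp
  then show 3: "int p mod 8 = 3" by (simp add: zmod_int)
  then show "odd (int p)" by presburger
qed

lemma int_indep: "of_int x + of_int y * s = 0 \<Longrightarrow> x = 0 \<and> y = 0"
  using rat_indep[of "of_int x" "of_int y"] by simp

text \<open>As d is 3 modulo 4, the form x^2 - d*y^2 is x^2 + y^2 modulo 4, and two odd squares add
  up to 2. So x and y are even.\<close>

lemma real_integers:
  assumes "d = int p" shows "quad_integers s 0 (- int p) (quad_field d)"
proof (rule integers_eqI)
  show "quad_ring s 0 (- int p)"
    by unfold_locales (use s_square assms int_indep in auto)
  have "s = of_rat 0 + of_rat 1 * s" by simp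
  then show "s \<in> quad_field d" unfolding quad_field_def s_def by blast
  show "\<exists>u v. (of_int x + of_int y * s) / 2 = of_int u + of_int v * s" if 4: "4 dvd x^2 - d * y^2" for x y
  proof -
    obtain j where j: "int p = 8*j + 3" using p_odd_prime(3) by (metis mult_div_mod_eq)
    have "x^2 - d*y^2 = (x^2 + y^2) - 4 * ((2*j + 1)*y^2)" unfolding assms j by (simp add: algebra_simps)
    then have sq: "4 dvd x^2 + y^2" using 4 by (metis dvd_add_right_iff dvd_triv_left diff_add_cancel dvd_add)
    have "even x \<and> even y"
    proof (rule ccontr)
      assume "\<not> (even x \<and> even y)"
      moreover have "even (x^2 + y^2)" using sq by (meson dvd_trans even_numeral)
      ultimately have "odd x" "odd y" by auto
      then obtain k l where "x^2 = 8*k+1" "y^2 = 8*l+1" using odd_square_mod_8 by (metis mult_div_mod_eq)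
      then show False using sq by presburger
    qed
    then obtain u v where "x = 2*u" "y = 2*v" by (metis evenE)
    then have "(of_int x + of_int y * s) / 2 = of_int u + of_int v * s" by (simp add: field_simps)
    then show ?thesis by blast
  qed
qed

lemma no_curve_real:
  assumes "d = int p" and E: "elliptic_curve_over (quad_field d) E"
    "everywhere_good_reduction (quad_field d) E" "j_invariant E \<in> \<rat>"
  shows False
proof -
  interpret quad_integers s 0 "- int p" "quad_field d" by (rule real_integers[OF assms(1)])
  \<comment> \<open>Here |h| is 1 or 7 modulo 8, so p * |h| is 3 or 5.\<close>
  have mod1: "odd h \<and> int p * \<bar>h\<bar> mod 8 \<noteq> 1" if "h mod 8 = 1" for h
  proof -
    have "\<bar>h\<bar> mod 8 = 1 \<or> \<bar>h\<bar> mod 8 = 7" "odd h" using that by presburger+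
    moreover have "int p * \<bar>h\<bar> mod 8 = (int p mod 8) * (\<bar>h\<bar> mod 8) mod 8" by (simp only: mod_mult_eq)
    ultimately show ?thesis unfolding p_odd_prime(3) by auto
  qed
  have mod5: "odd h \<and> \<bar>h\<bar> mod 8 \<noteq> 1" if "h mod 8 = 5" for h :: int
    using that by presburger
  have n8: "(- int p) mod 8 = 5" using p_odd_prime(3) by presburger
  show False
  proof (rule no_rational_j_everywhere_good[OF p_odd_prime(1,2) _ _ _ E])
    show "q = 2 \<or> q = int p" if "prime q" "q dvd 0^2 - 4 * (- int p)" for q
    proof -
      have "q dvd 2 * (2 * int p)" using that(2) by simp
      then have "q dvd 2 \<or> q dvd int p" using prime_dvd_multD[OF that(1)] by blast
      moreover have "prime (2::int)" by simp
      ultimately show ?thesis using primes_dvd_imp_eq[OF that(1)] p_odd_prime(1) by blast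
    qed
    have "prime (2::int)" "(2::int) dvd 0^2 - 4 * (- int p)" by simp_all
    then show "{z \<in> Zw. even (nrm z)} \<in> primes_of (quad_field d)"
      by (rule place_prime[OF ramified_place])
    fix a1 a2 a3 a4 a6 assume a: "a1 \<in> Zw" "a2 \<in> Zw" "a3 \<in> Zw" "a4 \<in> Zw" "a6 \<in> Zw"
      "odd (nrm (wdisc (a1,a2,a3,a4,a6)))"
    show
      "(\<exists>h. odd (nrm (wc4 (a1,a2,a3,a4,a6))) \<and> nrm (wc6 (a1,a2,a3,a4,a6)) = h \<and> odd h \<and> int p * \<bar>h\<bar> mod 8 \<noteq> 1) \<or>
      (\<exists>h k. nrm (wc4 (a1,a2,a3,a4,a6)) = 256 * k \<and> nrm (wc6 (a1,a2,a3,a4,a6)) = 64 * h \<and> odd h \<and> int p * \<bar>h\<bar> mod 8 \<noteq> 1) \<or>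
      (\<exists>h. nrm (wc4 (a1,a2,a3,a4,a6)) = 16 * h \<and> odd h \<and> \<bar>h\<bar> mod 8 \<noteq> 1)"
    proof (rule reduction_at_ramified_2[OF refl n8 a])
      assume "odd (nrm (wc4 (a1,a2,a3,a4,a6)))" "nrm (wc6 (a1,a2,a3,a4,a6)) mod 8 = 1"
      then show ?thesis using mod1 by blast
    next
      fix h k assume "nrm (wc4 (a1,a2,a3,a4,a6)) = 256 * k" "nrm (wc6 (a1,a2,a3,a4,a6)) = 64 * h" "h mod 8 = 1"
      then show ?thesis using mod1 by blast
    next
      fix h assume "nrm (wc4 (a1,a2,a3,a4,a6)) = 16 * h" "h mod 8 = 5"
      then show ?thesis using mod5 by blast
    qed
  qed
qed

text \<open>As d is 1 modulo 4, the coordinates x and y need only have the same parity, whence the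
  generator (1 + s)/2 of trace 1 and norm (1 + p)/4.\<close>

lemma imaginary_integers:
  assumes "d = - int p" shows "quad_integers ((1 + s) / 2) 1 ((1 + int p) div 4) (quad_field d)"
proof (rule integers_eqI)
  define n where "n = (1 + int p) div 4"
  have n: "4 * n = 1 + int p" unfolding n_def using p_odd_prime(3) by presburger
  have "of_int (4 * n) = (of_int (1 + int p) :: complex)" unfolding n ..
  then have n': "of_int n = (1 + of_int (int p)) / (4 :: complex)" by (simp add: field_simps)
  have s2: "s * s = - of_int (int p)" using s_square assms by (simp add: power2_eq_square)
  show "quad_ring ((1 + s) / 2) 1 ((1 + int p) div 4)"
    unfolding n_def[symmetric]
  proof
    show "((1 + s) / 2)^2 = of_int 1 * ((1 + s) / 2) - of_int n"
      unfolding n' by (simp add: power2_eq_square field_simps s2)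
    fix x y :: int assume "of_int x + of_int y * ((1 + s) / 2) = 0"
    then have "of_int (2*x + y) + of_int y * s = 0" by (simp add: field_simps)
    from int_indep[OF this] show "x = 0 \<and> y = 0" by simp
  qed
  have "(1 + s) / 2 = of_rat (1/2) + of_rat (1/2) * s" by (simp add: of_rat_divide add_divide_distrib)
  then show "(1 + s) / 2 \<in> quad_field d" unfolding quad_field_def s_def by blast
  show "\<exists>u v. (of_int x + of_int y * s) / 2 = of_int u + of_int v * ((1 + s) / 2)" if 4: "4 dvd x^2 - d * y^2" for x y
  proof -
    have "even (x^2 - d * y^2)" using 4 by (meson dvd_trans even_numeral)
    then have "even (x - y)" using p_odd_prime(2) unfolding assms by simp
    then obtain u where "x - y = 2*u" by (rule evenE)
    then have "x = y + 2*u" by simp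
    then have "(of_int x + of_int y * s) / 2 = of_int u + of_int y * ((1 + s) / 2)" by (simp add: field_simps)
    then show ?thesis by blast
  qed
qed

lemma no_curve_imaginary:
  assumes "d = - int p" and E: "elliptic_curve_over (quad_field d) E"
    "everywhere_good_reduction (quad_field d) E" "j_invariant E \<in> \<rat>"
  shows False
proof -
  define n where "n = (1 + int p) div 4"
  have n: "4 * n = 1 + int p" "odd n" unfolding n_def using p_odd_prime(3) by presburger+
  interpret quad_integers "(1 + s) / 2" 1 n "quad_field d"
    unfolding n_def by (rule imaginary_integers[OF assms(1)])
  have disc: "1^2 - 4 * n = - int p" using n(1) by simp
  have nonneg: "nrm z \<ge> 0" if "z \<in> Zw" for z
  proof -
    from that obtain x y where z: "z = el x y" by (rule el_cases)
    have "4 * nrm z = (2*x + y)^2 + (4*n - 1) * y^2" 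
      unfolding z nrm_el by (simp add: power2_eq_square algebra_simps)
    also have "\<dots> \<ge> 0" unfolding n(1) by simp
    finally show ?thesis by simp
  qed
  \<comment> \<open>Here h is 1 or 5 modulo 8, so p * h is 3 or 7.\<close>
  have mod1: "odd h \<and> int p * \<bar>h\<bar> mod 8 \<noteq> 1" if "h mod 4 = 1" "h \<ge> 0" for h
  proof -
    have "h mod 8 = 1 \<or> h mod 8 = 5" "odd h" using that(1) by presburger+
    moreover have "int p * h mod 8 = (int p mod 8) * (h mod 8) mod 8" by (simp only: mod_mult_eq)
    ultimately show ?thesis unfolding p_odd_prime(3) using that(2) by auto
  qed
  show False
  proof (rule no_rational_j_everywhere_good[OF p_odd_prime(1,2) _ _ _ E])
    show "q = 2 \<or> q = int p" if "prime q" "q dvd 1^2 - 4 * n" for q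
      using that p_odd_prime(1) primes_dvd_imp_eq[of q "int p"] unfolding disc by auto
    \<comment> \<open>Inertness of 2: r^2 - r is even and n is odd, the latter because p is 3 modulo
      8.\<close>
    have "is_place 2 2 {z \<in> Zw. even (nrm z)} (\<lambda>z. multiplicity 2 (nrm z))"
      by (rule inert_place(1)) (use n(2) in auto)
    then show "{z \<in> Zw. even (nrm z)} \<in> primes_of (quad_field d)" by (rule place_prime)
    fix a1 a2 a3 a4 a6 assume a: "a1 \<in> Zw" "a2 \<in> Zw" "a3 \<in> Zw" "a4 \<in> Zw" "a6 \<in> Zw"
      and disc: "odd (nrm (wdisc (a1,a2,a3,a4,a6)))"
    note nn = nonneg[OF weierstrass_invariants_in(2)[OF a]]
    have "odd (1::int)" by simp
    note red = reduction_at_inert_2[OF this n(2) a disc]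
    show
      "(\<exists>h. odd (nrm (wc4 (a1,a2,a3,a4,a6))) \<and> nrm (wc6 (a1,a2,a3,a4,a6)) = h \<and> odd h \<and> int p * \<bar>h\<bar> mod 8 \<noteq> 1) \<or>
      (\<exists>h k. nrm (wc4 (a1,a2,a3,a4,a6)) = 256 * k \<and> nrm (wc6 (a1,a2,a3,a4,a6)) = 64 * h \<and> odd h \<and> int p * \<bar>h\<bar> mod 8 \<noteq> 1) \<or>
      (\<exists>h. nrm (wc4 (a1,a2,a3,a4,a6)) = 16 * h \<and> odd h \<and> \<bar>h\<bar> mod 8 \<noteq> 1)"
    proof (rule red)
      assume "odd (nrm (wc4 (a1,a2,a3,a4,a6)))" "nrm (wc6 (a1,a2,a3,a4,a6)) mod 4 = 1"
      then show ?thesis using mod1[OF _ nn] by blast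
    next
      fix h k assume h: "nrm (wc4 (a1,a2,a3,a4,a6)) = 256 * k" "nrm (wc6 (a1,a2,a3,a4,a6)) = 64 * h" "h mod 4 = 1"
      then have "h \<ge> 0" using nn by simp
      then show ?thesis using mod1[OF h(3)] h(1,2) by blast
    qed
  qed
qed

end

theorem theorem1p7:
  fixes p :: nat
  assumes "prime p" and "p mod 8 = 3"
  shows "(\<not> (\<exists>E. elliptic_curve_over (quad_field (int p)) E \<and>
              everywhere_good_reduction (quad_field (int p)) E \<and> j_invariant E \<in> \<rat>)) \<and>
         (\<not> (\<exists>E. elliptic_curve_over (quad_field (- int p)) E \<and>
              everywhere_good_reduction (quad_field (- int p)) E \<and> j_invariant E \<in> \<rat>))"
proof -
  interpret re: quad_case p "int p" "csqrt (of_int (int p))" by unfold_locales (use assms in auto)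
  interpret im: quad_case p "- int p" "csqrt (of_int (- int p))" by unfold_locales (use assms in auto)
  show ?thesis using re.no_curve_real im.no_curve_imaginary by blast
qed

end
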